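(* Let $k$ be an algebraically closed field of countably infinite transcendence degree over $\mathbb{Q}$ and let $B$ be a Borel subgroup of a simple algebraic group over $k$. Then there exists an abstract group automorphism $\varphi$ of $B$ such that the associated $\varphi$-twisted conjugacy action of $B$ on itself is transitive.
   Context: An algebraic group over $k$ means a Zariski-closed subgroup of $\mathrm{GL}_n(k)$ for some $n\ge1$ (viewed as its group of $k$-points). A simple algebraic group is a connected non-commutative algebraic group with no nontrivial proper closed connected normal subgroup. A Borel subgroup is a maximal closed connected solvable subgroup. An abstract automorphism is any automorphism of the underlying group (not necessarily a morphism of varieties). The $\varphi$-twisted conjugacy action is $(g,x)\mapsto gx\varphi(g^{-1})$. *)

theory Defs
  imports
    "HOL-Analysis.Analysis"
    "HOL-Algebra.Solvable_Groups"
    "HOL-Algebra.Group_Action"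
    "HOL-Library.Poly_Mapping"
begin

section \<open>Multivariate polynomials\<close>

text \<open>
  A polynomial in variables of type \<^typ>\<open>'v\<close> is an element of the monoid algebra
  \<^typ>\<open>('v \<Rightarrow>\<^sub>0 nat) \<Rightarrow>\<^sub>0 'a\<close>: a finitely supported map from
  monomials (finitely supported exponent functions) to coefficients.
\<close>

definition monom_eval :: "('v \<Rightarrow> 'b::comm_semiring_1) \<Rightarrow> ('v \<Rightarrow>\<^sub>0 nat) \<Rightarrow> 'b"
  where "monom_eval x m = (\<Prod>v\<in>Poly_Mapping.keys m. x v ^ Poly_Mapping.lookup m v)"

text \<open>Here \<^term>\<open>c\<close> embeds the coefficients into the ring in which one evaluates.\<close>

definition mpoly_eval ::
    "('a::zero \<Rightarrow> 'b) \<Rightarrow> ('v \<Rightarrow> 'b::comm_semiring_1) \<Rightarrow> (('v \<Rightarrow>\<^sub>0 nat) \<Rightarrow>\<^sub>0 'a) \<Rightarrow> 'b"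
  where "mpoly_eval c x p = (\<Sum>m\<in>Poly_Mapping.keys p. c (Poly_Mapping.lookup p m) * monom_eval x m)"

definition mpoly_vars :: "(('v \<Rightarrow>\<^sub>0 nat) \<Rightarrow>\<^sub>0 'a::zero) \<Rightarrow> 'v set"
  where "mpoly_vars p = (\<Union>m\<in>Poly_Mapping.keys p. Poly_Mapping.keys m)"

lemma monom_eval_superset:
  assumes "finite V" "Poly_Mapping.keys m \<subseteq> V"
  shows "monom_eval x m = (\<Prod>v\<in>V. x v ^ Poly_Mapping.lookup m v)"
  unfolding monom_eval_def
  by (rule prod.mono_neutral_left) (use assms in \<open>auto simp: in_keys_iff\<close>)

lemma monom_eval_add: "monom_eval x (m + n) = monom_eval x m * monom_eval x n"
proof -
  let ?V = "Poly_Mapping.keys m \<union> Poly_Mapping.keys n"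
  have "monom_eval x (m + n) = (\<Prod>v\<in>?V. x v ^ Poly_Mapping.lookup (m + n) v)"
    by (rule monom_eval_superset) (auto simp: in_keys_iff lookup_add)
  also have "\<dots> = (\<Prod>v\<in>?V. x v ^ Poly_Mapping.lookup m v) * (\<Prod>v\<in>?V. x v ^ Poly_Mapping.lookup n v)"
    by (simp add: lookup_add power_add prod.distrib)
  also have "\<dots> = monom_eval x m * monom_eval x n"
    by (simp add: monom_eval_superset[of ?V m] monom_eval_superset[of ?V n])
  finally show ?thesis .
qed

lemma mpoly_eval_superset:
  assumes "finite M" "Poly_Mapping.keys p \<subseteq> M" "c 0 = 0"
  shows "mpoly_eval c x p = (\<Sum>m\<in>M. c (Poly_Mapping.lookup p m) * monom_eval x m)"
  unfolding mpoly_eval_def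
  by (rule sum.mono_neutral_left) (use assms in \<open>auto simp: in_keys_iff\<close>)

lemma mpoly_eval_0 [simp]: "mpoly_eval c x 0 = 0"
  by (simp add: mpoly_eval_def)

lemma mpoly_eval_single:
  "c 0 = 0 \<Longrightarrow> mpoly_eval c x (Poly_Mapping.single m a) = c a * monom_eval x m"
  by (simp add: mpoly_eval_def)

lemma mpoly_eval_1 [simp]: "mpoly_eval (\<lambda>a. a) x 1 = (1::'a::comm_semiring_1)"
  by (simp add: mpoly_eval_def monom_eval_def)

lemma mpoly_eval_add:
  fixes p q :: "('v \<Rightarrow>\<^sub>0 nat) \<Rightarrow>\<^sub>0 'a::comm_semiring_1"
  shows "mpoly_eval (\<lambda>a. a) x (p + q) = mpoly_eval (\<lambda>a. a) x p + mpoly_eval (\<lambda>a. a) x q"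
proof -
  let ?M = "Poly_Mapping.keys p \<union> Poly_Mapping.keys q"
  have "mpoly_eval (\<lambda>a. a) x (p + q) = (\<Sum>m\<in>?M. Poly_Mapping.lookup (p + q) m * monom_eval x m)"
    by (rule mpoly_eval_superset) (use Poly_Mapping.keys_add[of p q] in auto)
  also have "\<dots> = (\<Sum>m\<in>?M. Poly_Mapping.lookup p m * monom_eval x m) + (\<Sum>m\<in>?M. Poly_Mapping.lookup q m * monom_eval x m)"
    by (simp add: lookup_add distrib_right sum.distrib)
  also have "\<dots> = mpoly_eval (\<lambda>a. a) x p + mpoly_eval (\<lambda>a. a) x q"
    by (simp add: mpoly_eval_superset[of ?M p] mpoly_eval_superset[of ?M q])
  finally show ?thesis .
qed

lemma mpoly_induct [case_names zero single add]:
  fixes p :: "('v \<Rightarrow>\<^sub>0 nat) \<Rightarrow>\<^sub>0 'a::comm_monoid_add"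
  assumes "P 0" "\<And>m a. P (Poly_Mapping.single m a)" "\<And>p q. P p \<Longrightarrow> P q \<Longrightarrow> P (p + q)"
  shows "P p"
proof (induction p rule: update_induct)
  case const
  then show ?case using assms(1) by simp
next
  case (update f a b)
  have "Poly_Mapping.update a b f = f + Poly_Mapping.single a b"
    using update(1)
    by (intro poly_mapping_eqI) (auto simp: lookup_update lookup_add lookup_single in_keys_iff)
  then show ?case using assms(2,3) update by metis
qed

lemma mpoly_eval_mult:
  fixes p q :: "('v \<Rightarrow>\<^sub>0 nat) \<Rightarrow>\<^sub>0 'a::comm_semiring_1"
  shows "mpoly_eval (\<lambda>a. a) x (p * q) = mpoly_eval (\<lambda>a. a) x p * mpoly_eval (\<lambda>a. a) x q"
proof (induction p rule: mpoly_induct)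
  case (single m a)
  show ?case
  proof (induction q rule: mpoly_induct)
    case (single n b)
    show ?case
      by (simp add: mult_single mpoly_eval_single monom_eval_add mult_ac)
  qed (simp_all add: mpoly_eval_add distrib_left)
qed (simp_all add: mpoly_eval_add distrib_right)


section \<open>Transcendence bases over the rationals\<close>

text \<open>
  The elements of \<^term>\<open>S\<close> serve as their own variables, so a polynomial in the variables
  \<^term>\<open>S\<close> is evaluated at the identity assignment.
\<close>

definition algebraically_independent :: "'k::field_char_0 set \<Rightarrow> bool"
  where "algebraically_independent S \<longleftrightarrow>
    (\<forall>p :: ('k \<Rightarrow>\<^sub>0 nat) \<Rightarrow>\<^sub>0 rat.
      mpoly_vars p \<subseteq> S \<longrightarrow> mpoly_eval of_rat (\<lambda>s. s) p = 0 \<longrightarrow> p = 0)"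

definition transcendence_basis :: "'k::field_char_0 set \<Rightarrow> bool"
  where "transcendence_basis S \<longleftrightarrow> algebraically_independent S \<and>
    (\<forall>T. algebraically_independent T \<longrightarrow> S \<subseteq> T \<longrightarrow> T = S)"


section \<open>The general linear group and its Zariski topology\<close>

definition GL :: "('k::field^'n^'n) monoid"
  where "GL = \<lparr>carrier = {A. invertible A}, mult = (**), one = mat 1\<rparr>"

lemma group_GL: "group GL"
proof (rule groupI)
  fix A :: "'k::field^'n^'n" assume "A \<in> carrier GL"
  then show "\<exists>B\<in>carrier GL. B \<otimes>\<^bsub>GL\<^esub> A = \<one>\<^bsub>GL\<^esub>"
    by (auto simp: GL_def invertible_def)
qed (auto simp: GL_def matrix_mul_assoc invertible_mult, simp add: invertible_def)

text \<open>The group structure induced on a set of invertible matrices.\<close>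

abbreviation grp :: "('k::field^'n^'n) set \<Rightarrow> ('k^'n^'n) monoid"
  where "grp H \<equiv> GL\<lparr>carrier := H\<rparr>"

definition zero_locus :: "((('n \<times> 'n) \<Rightarrow>\<^sub>0 nat) \<Rightarrow>\<^sub>0 'k) set \<Rightarrow> ('k::field^'n^'n) set"
  where "zero_locus P =
    {A \<in> carrier GL. \<forall>p\<in>P. mpoly_eval (\<lambda>a. a) (\<lambda>(i, j). A $ i $ j) p = 0}"

definition zariski :: "('k::field^'n^'n) topology"
  where "zariski = topology (\<lambda>U. U \<subseteq> carrier GL \<and> (\<exists>P. carrier GL - U = zero_locus P))"

lemma istopology_zariski:
  "istopology (\<lambda>U. U \<subseteq> carrier GL \<and>
     (\<exists>P. carrier GL - U = (zero_locus P :: ('k::field^'n^'n) set)))"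
  unfolding istopology_def
proof (intro conjI allI impI; (elim conjE exE)?)
  fix U V :: "('k^'n^'n) set" and P Q
  assume *: "U \<subseteq> carrier GL" "V \<subseteq> carrier GL"
    "carrier GL - U = zero_locus P" "carrier GL - V = zero_locus Q"
  show "U \<inter> V \<subseteq> carrier GL" using * by blast
  have "carrier GL - U \<inter> V = zero_locus P \<union> zero_locus Q" using * by blast
  also have "\<dots> = zero_locus {p * q |p q. p \<in> P \<and> q \<in> Q}"
    unfolding zero_locus_def by (fastforce simp: mpoly_eval_mult)
  finally show "\<exists>P. carrier GL - U \<inter> V = zero_locus P" by blast
next
  fix K :: "('k^'n^'n) set set"
  assume *: "\<forall>U\<in>K. U \<subseteq> carrier GL \<and> (\<exists>P. carrier GL - U = zero_locus P)"
  then show "\<Union> K \<subseteq> carrier GL" by blast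
  obtain F where F: "\<And>U. U \<in> K \<Longrightarrow> carrier GL - U = zero_locus (F U)"
    using * by metis
  have "carrier GL - \<Union> K = {A \<in> carrier GL. \<forall>U\<in>K. A \<in> carrier GL - U}" by blast
  also have "\<dots> = {A \<in> carrier GL. \<forall>U\<in>K. A \<in> zero_locus (F U)}" using F by auto
  also have "\<dots> = zero_locus (\<Union>U\<in>K. F U)" unfolding zero_locus_def by blast
  finally show "\<exists>P. carrier GL - \<Union> K = zero_locus P" by blast
qed

lemma openin_zariski:
  "openin zariski U \<longleftrightarrow> U \<subseteq> carrier GL \<and> (\<exists>P. carrier GL - U = zero_locus P)"
  unfolding zariski_def by (subst topology_inverse'[OF istopology_zariski]) (rule refl)

lemma topspace_zariski [simp]: "topspace zariski = carrier GL"
proof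
  show "topspace zariski \<subseteq> carrier GL"
    by (auto simp: topspace_def openin_zariski)
  have "carrier GL - carrier GL = zero_locus {1}"
    by (auto simp: zero_locus_def)
  then show "carrier GL \<subseteq> topspace zariski"
    by (intro openin_subset) (auto simp: openin_zariski)
qed

lemma closedin_zariski: "closedin zariski C \<longleftrightarrow> (\<exists>P. C = zero_locus P)"
proof -
  have "zero_locus P \<subseteq> carrier GL" for P :: "((('n::finite \<times> 'n) \<Rightarrow>\<^sub>0 nat) \<Rightarrow>\<^sub>0 'k::field) set"
    by (auto simp: zero_locus_def)
  then show ?thesis
    unfolding closedin_def openin_zariski by (auto simp: double_diff)
qed


section \<open>Algebraic groups\<close>

text \<open>
  An algebraic group is a Zariski-closed subgroup of some \<open>GL\<^sub>n\<close>; the size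
  \<open>n\<close> is the cardinality of the finite index type, hence an arbitrary positive number.
  For a subset of an algebraic group, closedness and connectedness relative to that group
  agree with closedness and connectedness in \<open>GL\<^sub>n\<close>.
\<close>

definition algebraic_group :: "('k::field^'n^'n) set \<Rightarrow> bool"
  where "algebraic_group G \<longleftrightarrow> subgroup G GL \<and> closedin zariski G"

definition simple_algebraic_group :: "('k::field^'n^'n) set \<Rightarrow> bool"
  where "simple_algebraic_group G \<longleftrightarrow>
    algebraic_group G \<and> connectedin zariski G \<and> \<not> comm_group (grp G) \<and>
    (\<forall>N. N \<lhd> grp G \<longrightarrow> closedin zariski N \<longrightarrow> connectedin zariski N \<longrightarrow>
      N = {\<one>\<^bsub>GL\<^esub>} \<or> N = G)"

definition closed_connected_solvable_subgroup ::
    "('k::field^'n^'n) set \<Rightarrow> ('k^'n^'n) set \<Rightarrow> bool"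
  where "closed_connected_solvable_subgroup H G \<longleftrightarrow>
    subgroup H (grp G) \<and> closedin zariski H \<and> connectedin zariski H \<and> solvable (grp H)"

definition borel_subgroup :: "('k::field^'n^'n) set \<Rightarrow> ('k^'n^'n) set \<Rightarrow> bool"
  where "borel_subgroup B G \<longleftrightarrow> closed_connected_solvable_subgroup B G \<and>
    (\<forall>H. closed_connected_solvable_subgroup H G \<longrightarrow> B \<subseteq> H \<longrightarrow> H = B)"


section \<open>Twisted conjugacy\<close>

text \<open>
  The restriction to the carrier is needed because \<^const>\<open>BijGroup\<close>, and hence the
  locale \<^locale>\<open>group_action\<close>, is built from extensional functions.
\<close>

definition twisted_conj :: "('a, 'b) monoid_scheme \<Rightarrow> ('a \<Rightarrow> 'a) \<Rightarrow> 'a \<Rightarrow> 'a \<Rightarrow> 'a"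
  where "twisted_conj G \<phi> g =
    (\<lambda>x\<in>carrier G. g \<otimes>\<^bsub>G\<^esub> x \<otimes>\<^bsub>G\<^esub> \<phi> (inv\<^bsub>G\<^esub> g))"

end

theory Submission
  imports "HOL-Algebra.Finite_Extensions" Defs
begin

hide_const (open) Polynomials.degree Polynomials.lead_coeff
  up_ring.coeff up_ring.monom module.smult

text \<open>
  Let \<open>B\<close> be a connected closed subgroup of \<open>GL\<^sub>n\<close>. It suffices to find a field automorphism
  \<open>\<sigma>\<close> that fixes a finite set of elements over which \<open>B\<close> is defined and
  such that for each \<open>y \<in> B\<close> some \<open>g \<in> B\<close> has \<open>\<sigma>(g) = y g\<close>: this is Lang's theorem for \<open>\<sigma>\<close> in
  place of Frobenius, and says that the twisted orbit of \<open>1\<close> is all of \<open>B\<close>. As \<open>k\<close> is countable,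
  \<open>\<sigma>\<close> is built by back and forth from finite partial isomorphisms. To solve the equation
  for \<open>y\<close>, take \<open>g\<close> to be a generic point of \<open>B\<close> over all elements used so far; then \<open>y g\<close>
  is generic too, so \<open>g \<mapsto> y g\<close> extends the partial isomorphism. Generic points exist because
  \<open>B\<close> is irreducible and \<open>k\<close> has infinite transcendence degree over every finitely
  generated subfield.
\<close>

section \<open>Hilbert's basis theorem\<close>

text \<open>Field extensions are handled through vanishing: a point is known by the rational
  polynomials that vanish at it. Extending a partial isomorphism and constructing a generic point
  thereby become one problem, \<open>extend_specialisation\<close>: a valuation \<open>b\<close>
  satisfies exactly the relations valid on a prime family \<open>W\<close> of points and has to be
  given one more coordinate. For a partial isomorphism \<open>W\<close> is a single point; for a
  generic point it comes from all of \<open>B\<close>. The obstacle is the comparison of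
  \<open>g\<close> with \<open>y g\<close>. Relations at \<open>g\<close> have constants in the
  domain of the partial isomorphism, relations at \<open>y g\<close> have constants in its range;
  genericity relates each to vanishing on \<open>B\<close>, but not one to the other. So the finite
  partial isomorphism is first extended to a full automorphism, which preserves \<open>B\<close> and
  carries one vanishing statement to the other: a complete back and forth runs inside every step of
  the final one. Hilbert's theorem serves twice: it gives the irreducible components behind
  primality, and finitely many equations, hence finitely many constants, so that every stage stays
  finite and leaves transcendental elements over.\<close>

inductive_set ideal_in :: "'r::comm_ring_1 set \<Rightarrow> 'r set \<Rightarrow> 'r set" for R A where
  zero: "0 \<in> ideal_in R A"
| step: "\<lbrakk>r \<in> R; a \<in> A; x \<in> ideal_in R A\<rbrakk> \<Longrightarrow> r * a + x \<in> ideal_in R A"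

text \<open>Rings are subsets of one ambient type, so that an induction on the number of variables
  can climb a chain of subrings without changing the type.\<close>

definition subring_set :: "'r::comm_ring_1 set \<Rightarrow> bool" where
  "subring_set R \<longleftrightarrow> 0 \<in> R \<and> 1 \<in> R \<and> (\<forall>x\<in>R. - x \<in> R) \<and>
    (\<forall>x\<in>R. \<forall>y\<in>R. x + y \<in> R \<and> x * y \<in> R)"

lemma subring_setD:
  assumes "subring_set R"
  shows "0 \<in> R" "1 \<in> R" "x \<in> R \<Longrightarrow> - x \<in> R" "x \<in> R \<Longrightarrow> y \<in> R \<Longrightarrow> x + y \<in> R"
    "x \<in> R \<Longrightarrow> y \<in> R \<Longrightarrow> x - y \<in> R" "x \<in> R \<Longrightarrow> y \<in> R \<Longrightarrow> x * y \<in> R"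
  using assms unfolding subring_set_def diff_conv_add_uminus by blast+

lemma subring_set_sum:
  assumes "subring_set R" "\<And>i. i \<in> I \<Longrightarrow> f i \<in> R"
  shows "sum f I \<in> R"
  using assms(2) by (induction I rule: infinite_finite_induct) (auto simp: subring_setD[OF assms(1)])

lemma ideal_in_incl:
  assumes "subring_set R" "a \<in> A"
  shows "a \<in> ideal_in R A"
  using ideal_in.step[OF subring_setD(2)[OF assms(1)] assms(2) ideal_in.zero] by simp

lemma ideal_in_add: "x \<in> ideal_in R A \<Longrightarrow> y \<in> ideal_in R A \<Longrightarrow> x + y \<in> ideal_in R A"
  by (induction x rule: ideal_in.induct) (auto simp: add.assoc intro: ideal_in.step)

lemma ideal_in_sum: "(\<And>i. i \<in> I \<Longrightarrow> f i \<in> ideal_in R A) \<Longrightarrow> sum f I \<in> ideal_in R A"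
  by (induction I rule: infinite_finite_induct) (auto intro: ideal_in.zero ideal_in_add)

lemma ideal_in_mult:
  assumes "subring_set R" "r \<in> R"
  shows "x \<in> ideal_in R A \<Longrightarrow> r * x \<in> ideal_in R A"
  by (induction x rule: ideal_in.induct)
    (use assms in \<open>auto simp: distrib_left mult.assoc[symmetric] subring_setD intro: ideal_in.intros\<close>)

lemma ideal_in_trans:
  assumes "subring_set R" "A \<subseteq> ideal_in R B"
  shows "x \<in> ideal_in R A \<Longrightarrow> x \<in> ideal_in R B"
  by (induction x rule: ideal_in.induct)
    (use assms in \<open>auto intro!: ideal_in.zero ideal_in_add ideal_in_mult\<close>)

lemma ideal_in_mono: "A \<subseteq> B \<Longrightarrow> R \<subseteq> R' \<Longrightarrow> x \<in> ideal_in R A \<Longrightarrow> x \<in> ideal_in R' B"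
  by (rotate_tac 2, induction x rule: ideal_in.induct) (auto intro: ideal_in.intros)

lemma ideal_in_finite:
  "x \<in> ideal_in R A \<Longrightarrow> \<exists>A0. finite A0 \<and> A0 \<subseteq> A \<and> x \<in> ideal_in R A0"
proof (induction x rule: ideal_in.induct)
  case zero
  then show ?case by (intro exI[of _ "{}"]) (auto intro: ideal_in.zero)
next
  case (step r a x)
  then obtain A0 where "finite A0" "A0 \<subseteq> A" "x \<in> ideal_in R A0" by blast
  with step show ?case
    by (intro exI[of _ "insert a A0"]) (auto intro!: ideal_in.step intro: ideal_in_mono)
qed

lemma ideal_in_Suc_sum:
  assumes "x \<in> ideal_in R (f ` {..<n::nat})" "subring_set R"
  shows "\<exists>c. (\<forall>i. c i \<in> R) \<and> x = (\<Sum>i<n. c i * f i)"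
  using assms(1)
proof (induction x rule: ideal_in.induct)
  case zero
  then show ?case using subring_setD[OF assms(2)] by (intro exI[of _ "\<lambda>_. 0"]) auto
next
  case (step r a x)
  then obtain c where c: "\<forall>i. c i \<in> R" "x = (\<Sum>i<n. c i * f i)" by blast
  obtain j where j: "j < n" "a = f j" using step by blast
  let ?c = "\<lambda>i. if i = j then r + c i else c i"
  have "(\<Sum>i<n. ?c i * f i) = (\<Sum>i<n. (if i = j then r * f i else 0) + c i * f i)"
    by (intro sum.cong) (auto simp: algebra_simps)
  also have "\<dots> = r * a + x"
    using j by (simp add: sum.distrib c(2))
  finally show ?case
    using c(1) step subring_setD[OF assms(2)] by (intro exI[of _ ?c]) auto
qed

text \<open>The ascending chain condition in terms of sequences. Applied to leading coefficients, it
  directly yields the linear relation that Hilbert's argument needs.\<close>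

definition noetherian_set :: "'r::comm_ring_1 set \<Rightarrow> bool" where
  "noetherian_set R \<longleftrightarrow>
    (\<forall>f :: nat \<Rightarrow> 'r. range f \<subseteq> R \<longrightarrow> (\<exists>n. f n \<in> ideal_in R (f ` {..<n})))"

text \<open>Otherwise every finite part of \<open>P\<close> leaves some element of \<open>P\<close>
  outside its ideal, and choosing such elements one after another gives a sequence that violates the
  chain condition.\<close>

lemma noetherian_set_finite_basis:
  assumes "noetherian_set R" "P \<subseteq> R"
  shows "\<exists>P0. finite P0 \<and> P0 \<subseteq> P \<and> P \<subseteq> ideal_in R P0"
proof (rule ccontr)
  assume *: "\<not> ?thesis"
  have "\<exists>f. \<forall>n::nat. f n \<in> P \<and> f n \<notin> ideal_in R (f ` {..<n})"
  proof (rule dependent_wellorder_choice)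
    fix r n and f g :: "nat \<Rightarrow> 'a" assume "\<And>y. y < n \<Longrightarrow> f y = g y"
    then have "f ` {..<n} = g ` {..<n}" by (intro image_cong) auto
    then show "(r \<in> P \<and> r \<notin> ideal_in R (f ` {..<n})) = (r \<in> P \<and> r \<notin> ideal_in R (g ` {..<n}))"
      by simp
  next
    fix n and f :: "nat \<Rightarrow> 'a" assume "\<And>y. y < n \<Longrightarrow> f y \<in> P \<and> f y \<notin> ideal_in R (f ` {..<y})"
    then have "f ` {..<n} \<subseteq> P" by auto
    then show "\<exists>r. r \<in> P \<and> r \<notin> ideal_in R (f ` {..<n})"
      using * by blast
  qed
  then obtain f where "\<And>n::nat. f n \<in> P \<and> f n \<notin> ideal_in R (f ` {..<n})" by blast
  with assms show False unfolding noetherian_set_def by blast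
qed

text \<open>The image of the polynomial ring over \<open>R\<close> under evaluation at
  \<open>x\<close>. As \<open>x\<close> may satisfy relations over \<open>R\<close>, an element has
  in general many representing polynomials.\<close>

definition adjoin :: "'r::comm_ring_1 set \<Rightarrow> 'r \<Rightarrow> 'r set" where
  "adjoin R x = {poly p x |p. \<forall>i. coeff p i \<in> R}"

lemma subring_adjoin:
  assumes "subring_set R"
  shows "subring_set (adjoin R x)"
proof -
  note R = subring_setD[OF assms]
  have I: "poly p x \<in> adjoin R x" if "\<forall>i. coeff p i \<in> R" for p
    using that unfolding adjoin_def by blast
  have mult: "\<forall>i. coeff (p * q) i \<in> R" if "\<forall>i. coeff p i \<in> R" "\<forall>i. coeff q i \<in> R" for p q
    using that by (auto simp: coeff_mult intro!: subring_set_sum[OF assms] R)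
  show ?thesis
    unfolding subring_set_def
  proof (intro conjI ballI)
    show "0 \<in> adjoin R x" "1 \<in> adjoin R x"
      using I[of 0] I[of "[:1:]"] by (auto simp: R coeff_pCons split: nat.split)
  next
    fix a assume "a \<in> adjoin R x"
    then obtain p where p: "\<forall>i. coeff p i \<in> R" "a = poly p x" by (auto simp: adjoin_def)
    then show "- a \<in> adjoin R x" using I[of "- p"] by (simp add: R)
    fix b assume "b \<in> adjoin R x"
    then obtain q where q: "\<forall>i. coeff q i \<in> R" "b = poly q x" by (auto simp: adjoin_def)
    show "a + b \<in> adjoin R x" using I[of "p + q"] p q by (simp add: R)
    show "a * b \<in> adjoin R x" using I[OF mult] p q by (metis poly_mult)
  qed
qed

lemma adjoin_incl:
  assumes "subring_set R"
  shows "R \<subseteq> adjoin R x" "x \<in> adjoin R x"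
proof -
  note R = subring_setD[OF assms]
  show "R \<subseteq> adjoin R x"
  proof
    fix r assume "r \<in> R"
    then have "\<forall>i. coeff [:r:] i \<in> R" by (auto simp: R coeff_pCons split: nat.split)
    then have "poly [:r:] x \<in> adjoin R x" unfolding adjoin_def by blast
    then show "r \<in> adjoin R x" by simp
  qed
  have "\<forall>i. coeff [:0, 1:] i \<in> R" by (auto simp: R coeff_pCons split: nat.split)
  then have "poly [:0, 1:] x \<in> adjoin R x" unfolding adjoin_def by blast
  then show "x \<in> adjoin R x" by simp
qed

lemma subring_power: "subring_set R \<Longrightarrow> x \<in> R \<Longrightarrow> x ^ n \<in> R"
  by (induction n) (auto simp: subring_setD)

text \<open>
  Hilbert's argument in terms of sequences: pick \<open>f n\<close> of least degree outside the ideal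
  generated by its predecessors; a relation among the leading coefficients lowers that degree.
\<close>

theorem noetherian_adjoin:
  fixes x :: "'r::comm_ring_1"
  assumes R: "subring_set R" and noeth: "noetherian_set R"
  shows "noetherian_set (adjoin R x)"
  unfolding noetherian_set_def
proof (intro allI impI, rule ccontr)
  fix g :: "nat \<Rightarrow> 'r"
  let ?S = "adjoin R x"
  let ?I = "ideal_in ?S (range g)"
  assume g: "range g \<subseteq> ?S" and bad: "\<nexists>n. g n \<in> ideal_in ?S (g ` {..<n})"
  note S = subring_adjoin[OF R, of x]
  note RD = subring_setD[OF R]
  \<comment> \<open>Finitely many generators of \<open>?I\<close> would involve only finitely many
    \<open>g j\<close>, and a later \<open>g n\<close> would lie in the ideal of its
    predecessors.\<close>
  have not_fg: "\<exists>r\<in>?I. r \<notin> ideal_in ?S A" if A: "finite A" "A \<subseteq> ?I" for A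
  proof (rule ccontr)
    assume "\<not> ?thesis"
    then have I: "?I \<subseteq> ideal_in ?S A" by blast
    have "\<forall>a\<in>A. \<exists>A0. finite A0 \<and> A0 \<subseteq> range g \<and> a \<in> ideal_in ?S A0"
      using A ideal_in_finite by blast
    then obtain F where F: "\<And>a. a \<in> A \<Longrightarrow> finite (F a) \<and> F a \<subseteq> range g \<and> a \<in> ideal_in ?S (F a)"
      by metis
    have "finite (\<Union>a\<in>A. F a)" "(\<Union>a\<in>A. F a) \<subseteq> range g" using F A by auto
    then obtain J where J: "finite J" "(\<Union>a\<in>A. F a) = g ` J"
      using finite_subset_image by metis
    obtain n where n: "J \<subseteq> {..<n}" using J(1) finite_nat_iff_bounded by blast
    have "A \<subseteq> ideal_in ?S (g ` {..<n})"
    proof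
      fix a assume a: "a \<in> A"
      then have "F a \<subseteq> g ` {..<n}" using J n by blast
      with F[OF a] show "a \<in> ideal_in ?S (g ` {..<n})" using ideal_in_mono by blast
    qed
    moreover have "g n \<in> ideal_in ?S A" using I ideal_in_incl[OF S, of "g n" "range g"] by blast
    ultimately show False using bad ideal_in_trans[OF S] by blast
  qed
  \<comment> \<open>A degree bound for some representing polynomial, as the degree of an element is
    not well defined. The bound is strict: bound 0 forces the element 0, which is why the chosen
    elements have positive \<open>d n\<close>.\<close>
  define ht where "ht r d \<longleftrightarrow> (\<exists>p. (\<forall>i. coeff p i \<in> R) \<and> (\<forall>i\<ge>d. coeff p i = 0) \<and> poly p x = r)" for r d
  have ht_ex: "\<exists>d. ht r d" if r: "r \<in> ?S" for r
  proof -
    obtain p where p: "\<forall>i. coeff p i \<in> R" "poly p x = r" using r by (auto simp: adjoin_def)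
    moreover have "\<forall>i\<ge>Suc (degree p). coeff p i = 0" by (auto intro!: coeff_eq_0)
    ultimately show ?thesis unfolding ht_def by blast
  qed
  have IS: "?I \<subseteq> ?S"
  proof
    show "r \<in> ?S" if "r \<in> ?I" for r
      using that by induction (use g subring_setD[OF S] in auto)
  qed
  let ?ok = "\<lambda>A r. r \<in> ?I \<and> r \<notin> ideal_in ?S A"
  \<comment> \<open>Each choice records an element together with the least degree bound attained
    outside the ideal of the earlier choices.\<close>
  let ?P = "\<lambda>f n (r, d). ?ok (fst ` f ` {..<n::nat}) r \<and> ht r d \<and>
     (\<forall>r' d'. ?ok (fst ` f ` {..<n}) r' \<longrightarrow> ht r' d' \<longrightarrow> d \<le> d')"
  have "\<exists>f. \<forall>n::nat. ?P f n (f n)"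
  proof (rule dependent_wellorder_choice)
    fix rd n and f g :: "nat \<Rightarrow> 'r \<times> nat" assume "\<And>y. y < n \<Longrightarrow> f y = g y"
    then have "f ` {..<n} = g ` {..<n}" by (intro image_cong) auto
    then show "?P f n rd = ?P g n rd" by simp
  next
    fix n and f :: "nat \<Rightarrow> 'r \<times> nat" assume *: "\<And>y. y < n \<Longrightarrow> ?P f y (f y)"
    have "fst ` f ` {..<n} \<subseteq> ?I" using * by (auto simp: case_prod_unfold)
    from not_fg[OF _ this] obtain r where r: "?ok (fst ` f ` {..<n}) r" by auto
    let ?Q = "\<lambda>d. \<exists>r. ?ok (fst ` f ` {..<n}) r \<and> ht r d"
    obtain d where "ht r d" using ht_ex r IS by blast
    with r have "?Q d" by (intro exI[of _ r] conjI) auto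
    then have "?Q (LEAST d. ?Q d)" by (rule LeastI[of ?Q])
    then obtain r where "?ok (fst ` f ` {..<n}) r \<and> ht r (LEAST d. ?Q d)" by blast
    moreover have "\<forall>r' d'. ?ok (fst ` f ` {..<n}) r' \<longrightarrow> ht r' d' \<longrightarrow> (LEAST d. ?Q d) \<le> d'"
      by (intro allI impI Least_le[of ?Q]) (rule exI, rule conjI)
    ultimately have "?P f n (r, LEAST d. ?Q d)" by simp
    then show "\<exists>rd. ?P f n rd" by blast
  qed
  then obtain fd where fd: "\<And>n. ?P fd n (fd n)" by blast
  define f where "f n = fst (fd n)" for n
  define d where "d n = snd (fd n)" for n
  have f1: "f n \<in> ?I" "f n \<notin> ideal_in ?S (f ` {..<n})" "ht (f n) (d n)" for n
    using fd[of n] by (auto simp: f_def d_def case_prod_unfold image_image)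
  have f2: "d n \<le> d'" if "r' \<in> ?I" "r' \<notin> ideal_in ?S (f ` {..<n})" "ht r' d'" for n r' d'
    using fd[of n] that by (auto simp: f_def d_def case_prod_unfold image_image)
  have "\<forall>n. \<exists>p. (\<forall>i. coeff p i \<in> R) \<and> (\<forall>i\<ge>d n. coeff p i = 0) \<and> poly p x = f n"
    using f1(3) unfolding ht_def by blast
  then obtain p where p: "\<And>n i. coeff (p n) i \<in> R" "\<And>n i. i \<ge> d n \<Longrightarrow> coeff (p n) i = 0"
      "\<And>n. poly (p n) x = f n"
    by metis
  have dpos: "d n > 0" for n
  proof (rule ccontr)
    assume "\<not> d n > 0"
    then have "p n = 0" using p(2)[of n] by (simp add: poly_eq_iff)
    then have "f n = 0" using p(3)[of n] by simp
    then show False using f1(2)[of n] ideal_in.zero by auto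
  qed
  have dmono: "d i \<le> d n" if "i \<le> n" for i n
  proof -
    have "f n \<notin> ideal_in ?S (f ` {..<i})"
    proof
      assume "f n \<in> ideal_in ?S (f ` {..<i})"
      moreover have "f ` {..<i} \<subseteq> f ` {..<n}" using that by auto
      ultimately show False using f1(2)[of n] ideal_in_mono by blast
    qed
    then show ?thesis using f2[OF f1(1) _ f1(3)] by blast
  qed
  define a where "a n = coeff (p n) (d n - 1)" for n
  have "range a \<subseteq> R" using p(1) by (auto simp: a_def)
  then obtain n where "a n \<in> ideal_in R (a ` {..<n})"
    using noeth unfolding noetherian_set_def by blast
  then obtain c where c: "\<And>i. c i \<in> R" "a n = (\<Sum>i<n. c i * a i)"
    using ideal_in_Suc_sum[OF _ R] by metis
  \<comment> \<open>The shifts by \<open>d n - d i\<close> bring all leading terms to position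
    \<open>d n - 1\<close>, where the relation among the leading coefficients makes
    \<open>p n - s\<close> vanish. The natural subtraction is exact because \<open>d\<close> is
    monotone.\<close>
  define s where "s = (\<Sum>i<n. monom (c i) (d n - d i) * p i)"
  define h where "h = p n - s"
  have cm: "coeff (monom (c i) k * p j) m = (if k \<le> m then c i * coeff (p j) (m - k) else 0)" for i j k m
    by (auto simp: coeff_monom_mult)
  have "\<forall>i. coeff h i \<in> R"
  proof
    have "coeff (monom (c j) (d n - d j) * p j) i \<in> R" for i j
      unfolding cm using c(1) p(1) RD(1,6) by simp
    then have "coeff s i \<in> R" for i
      unfolding s_def coeff_sum by (rule subring_set_sum[OF R])
    then show "coeff h i \<in> R" for i unfolding h_def coeff_diff by (rule RD(5)[OF p(1)])
  qed
  moreover have "coeff h i = 0" if i: "i \<ge> d n - 1" for i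
  proof (cases "i = d n - 1")
    case True
    have "coeff s i = (\<Sum>j<n. c j * a j)"
      unfolding s_def coeff_sum
    proof (intro sum.cong refl)
      fix j assume "j \<in> {..<n}"
      then have j: "d j \<le> d n" using dmono by simp
      have "d n - d j \<le> i" "i - (d n - d j) = d j - 1"
        using True j dpos[of j] by auto
      then show "coeff (monom (c j) (d n - d j) * p j) i = c j * a j"
        by (simp add: cm a_def)
    qed
    then show ?thesis using c(2) True by (simp add: h_def a_def)
  next
    case False
    then have i: "i \<ge> d n" using i by auto
    have "coeff s i = 0"
      unfolding s_def coeff_sum
    proof (intro sum.neutral ballI)
      fix j assume "j \<in> {..<n}"
      then have "d j \<le> d n" using dmono by simp
      then have "i - (d n - d j) \<ge> d j" using i by auto
      then show "coeff (monom (c j) (d n - d j) * p j) i = 0" by (simp add: cm p(2))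
    qed
    then show ?thesis using p(2)[OF i] by (simp add: h_def)
  qed
  ultimately have ht_h: "ht (poly h x) (d n - 1)" unfolding ht_def by blast
  have polyS: "poly (monom (c i) k) x \<in> ?S" for i k
    unfolding poly_monom
    by (rule subring_setD(6)[OF S _ subring_power[OF S]]) (use adjoin_incl[OF R, of x] c(1) in blast)+
  have s_in: "poly s x \<in> ideal_in ?S (f ` {..<n})"
    unfolding s_def poly_sum
  proof (rule ideal_in_sum)
    show "poly (monom (c i) (d n - d i) * p i) x \<in> ideal_in ?S (f ` {..<n})"
      if "i \<in> {..<n}" for i
      unfolding poly_mult p(3) using that by (intro ideal_in_mult[OF S] polyS ideal_in_incl[OF S] imageI)
  qed
  have f_eq: "f n = poly h x + poly s x" by (simp add: h_def p(3))
  have "poly h x \<notin> ideal_in ?S (f ` {..<n})"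
    using f1(2)[of n] ideal_in_add[OF _ s_in] unfolding f_eq by blast
  moreover have "poly h x \<in> ?I"
  proof -
    have "f ` {..<n} \<subseteq> ?I" using f1(1) by blast
    then have "poly s x \<in> ?I" using ideal_in_trans[OF S _ s_in] by blast
    then have "(- 1) * poly s x \<in> ?I"
      by (rule ideal_in_mult[OF S subring_setD(3)[OF S subring_setD(2)[OF S]]])
    moreover have "poly h x = f n + (- 1) * poly s x" using f_eq by simp
    ultimately show ?thesis using ideal_in_add[OF f1(1)] by metis
  qed
  ultimately have "d n \<le> d n - 1" using f2[OF _ _ ht_h] by blast
  with dpos[of n] show False by simp
qed

text \<open>Monomials are grouped by their exponent of \<open>v\<close>, which \<open>?r\<close>
  erases. Isolating one variable drives the induction for Hilbert's theorem and later turns an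
  algebraic dependence into a one-variable equation.\<close>

lemma mpoly_as_poly:
  fixes p :: "('v \<Rightarrow>\<^sub>0 nat) \<Rightarrow>\<^sub>0 'a::comm_ring_1"
  assumes "mpoly_vars p \<subseteq> insert v V"
  shows "\<exists>Q. (\<forall>i. mpoly_vars (coeff Q i) \<subseteq> V) \<and>
    p = poly Q (Poly_Mapping.single (Poly_Mapping.single v 1) 1)"
proof -
  let ?X = "Poly_Mapping.single (Poly_Mapping.single v 1) (1::'a)"
  let ?r = "\<lambda>m. Poly_Mapping.update v 0 m :: 'v \<Rightarrow>\<^sub>0 nat"
  define Q where "Q = (\<Sum>m\<in>Poly_Mapping.keys p.
    monom (Poly_Mapping.single (?r m) (Poly_Mapping.lookup p m)) (Poly_Mapping.lookup m v))"
  have X: "?X ^ n = Poly_Mapping.single (Poly_Mapping.single v n) 1" for n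
    by (induction n) (auto simp: mult_single single_add[symmetric])
  have m: "?r m + Poly_Mapping.single v (Poly_Mapping.lookup m v) = m" for m
    by (rule poly_mapping_eqI) (auto simp: lookup_add lookup_update lookup_single when_def)
  have "poly Q ?X = (\<Sum>m\<in>Poly_Mapping.keys p. Poly_Mapping.single m (Poly_Mapping.lookup p m))"
    unfolding Q_def by (simp add: poly_sum poly_monom X[simplified] mult_single m)
  also have "\<dots> = p"
    by (rule poly_mapping_eqI)
      (simp add: lookup_sum lookup_single when_def in_keys_iff)
  finally have "p = poly Q ?X" by simp
  moreover have "mpoly_vars (coeff Q i) \<subseteq> V" for i
  proof
    fix u assume "u \<in> mpoly_vars (coeff Q i)"
    then obtain m' where m': "m' \<in> Poly_Mapping.keys (coeff Q i)" "u \<in> Poly_Mapping.keys m'"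
      unfolding mpoly_vars_def by blast
    have "coeff Q i = (\<Sum>m\<in>Poly_Mapping.keys p.
      if Poly_Mapping.lookup m v = i then Poly_Mapping.single (?r m) (Poly_Mapping.lookup p m) else 0)"
      unfolding Q_def by (simp add: coeff_sum)
    then have "Poly_Mapping.lookup (coeff Q i) m' = (\<Sum>m\<in>Poly_Mapping.keys p.
      Poly_Mapping.lookup (if Poly_Mapping.lookup m v = i then Poly_Mapping.single (?r m) (Poly_Mapping.lookup p m) else 0) m')"
      by (simp add: lookup_sum)
    moreover have "Poly_Mapping.lookup (coeff Q i) m' \<noteq> 0" using m' by (simp add: in_keys_iff)
    ultimately obtain m where m: "m \<in> Poly_Mapping.keys p" "m' = ?r m"
      by (smt (verit, best) lookup_single_not_eq lookup_zero sum.neutral)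
    have "u \<noteq> v" "u \<in> Poly_Mapping.keys m"
      using m'(2) unfolding m(2) by (auto simp: in_keys_iff lookup_update split: if_splits)
    then show "u \<in> V" using m(1) assms unfolding mpoly_vars_def by blast
  qed
  ultimately show ?thesis by blast
qed

text \<open>The induction on \<open>V\<close> only asks for some Noetherian subring containing all
  polynomials in \<open>V\<close>; for the full set of variables this subring is everything.\<close>

theorem noetherian_mpoly:
  "noetherian_set (UNIV :: (('v::finite \<Rightarrow>\<^sub>0 nat) \<Rightarrow>\<^sub>0 'k::field) set)"
proof -
  have "\<exists>R :: (('v \<Rightarrow>\<^sub>0 nat) \<Rightarrow>\<^sub>0 'k) set.
      subring_set R \<and> noetherian_set R \<and> {p. mpoly_vars p \<subseteq> V} \<subseteq> R" if "finite V" for V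
    using that
  proof induction
    case empty
    let ?c = "Poly_Mapping.single 0 :: 'k \<Rightarrow> (('v \<Rightarrow>\<^sub>0 nat) \<Rightarrow>\<^sub>0 'k)"
    have sub: "subring_set (range ?c)"
    proof -
      have "0 \<in> range ?c" "1 \<in> range ?c"
        by (metis rangeI single_zero, metis rangeI single_one)
      then show ?thesis
        unfolding subring_set_def
        by (auto simp: mult_single single_add[symmetric] single_uminus[symmetric])
    qed
    have "noetherian_set (range ?c)"
      unfolding noetherian_set_def
    proof (intro allI impI)
      fix f :: "nat \<Rightarrow> _" assume "range f \<subseteq> range ?c"
      then have "\<forall>n. \<exists>c. f n = ?c c" by blast
      then obtain c where c: "\<And>n. f n = ?c (c n)" by metis
      show "\<exists>n. f n \<in> ideal_in (range ?c) (f ` {..<n})"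
      \<comment> \<open>The constants form a field: the first term is either 0, hence in the ideal
        of the empty set, or a unit, and then divides the second term.\<close>
      proof (cases "c 0 = 0")
        case True
        then show ?thesis by (intro exI[of _ 0]) (auto simp: c intro: ideal_in.zero)
      next
        case False
        then have "f 1 = ?c (c 1 / c 0) * f 0 + 0" by (simp add: c mult_single)
        also have "\<dots> \<in> ideal_in (range ?c) (f ` {..<1})"
          by (intro ideal_in.intros) auto
        finally show ?thesis by blast
      qed
    qed
    moreover have "p \<in> range ?c" if "mpoly_vars p \<subseteq> {}" for p
    proof -
      have "Poly_Mapping.keys p \<subseteq> {0}"
        using that by (auto simp: mpoly_vars_def)
      then have "p = ?c (Poly_Mapping.lookup p 0)"
        by (intro poly_mapping_eqI) (auto simp: lookup_single when_def in_keys_iff)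
      then show ?thesis by blast
    qed
    ultimately show ?case using sub by blast
  next
    case (insert v V)
    then obtain R :: "(('v \<Rightarrow>\<^sub>0 nat) \<Rightarrow>\<^sub>0 'k) set" where
      R: "subring_set R" "noetherian_set R" "{p. mpoly_vars p \<subseteq> V} \<subseteq> R" by blast
    let ?S = "adjoin R (Poly_Mapping.single (Poly_Mapping.single v 1) 1)"
    have "p \<in> ?S" if "mpoly_vars p \<subseteq> insert v V" for p
      using mpoly_as_poly[OF that] R(3) unfolding adjoin_def by blast
    then show ?case
      using subring_adjoin[OF R(1)] noetherian_adjoin[OF R(1,2)] by blast
  qed
  from this[OF finite_class.finite_UNIV] obtain R :: "(('v \<Rightarrow>\<^sub>0 nat) \<Rightarrow>\<^sub>0 'k) set"
    where "noetherian_set R" "{p. mpoly_vars p \<subseteq> UNIV} \<subseteq> R" by blast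
  moreover have "{p :: ('v \<Rightarrow>\<^sub>0 nat) \<Rightarrow>\<^sub>0 'k. mpoly_vars p \<subseteq> UNIV} = UNIV" by simp
  ultimately show ?thesis by (simp only: top.extremum_unique)
qed

section \<open>Polynomial functions and the Zariski topology\<close>

text \<open>Functions instead of formal polynomials: substitution is composition, one
  \<open>f\<close> can be evaluated at different valuations, and \<open>C\<close> and
  \<open>V\<close> record which constants and variables occur.\<close>

inductive_set polyfun :: "'k::comm_ring_1 set \<Rightarrow> 'v set \<Rightarrow> (('v \<Rightarrow> 'k) \<Rightarrow> 'k) set" for C V where
  const: "c \<in> C \<Longrightarrow> (\<lambda>_. c) \<in> polyfun C V"
| var: "v \<in> V \<Longrightarrow> (\<lambda>w. w v) \<in> polyfun C V"
| add: "\<lbrakk>f \<in> polyfun C V; g \<in> polyfun C V\<rbrakk> \<Longrightarrow> (\<lambda>w. f w + g w) \<in> polyfun C V"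
| mult: "\<lbrakk>f \<in> polyfun C V; g \<in> polyfun C V\<rbrakk> \<Longrightarrow> (\<lambda>w. f w * g w) \<in> polyfun C V"

lemma polyfun_mono:
  assumes "f \<in> polyfun C V" "C \<subseteq> C'" "V \<subseteq> V'"
  shows "f \<in> polyfun C' V'"
  using assms(1) by induction (use assms in \<open>auto intro: polyfun.intros\<close>)

lemma polyfun_cong:
  assumes "f \<in> polyfun C V" "\<And>v. v \<in> V \<Longrightarrow> w v = w' v"
  shows "f w = f w'"
  using assms(1) by induction (use assms in auto)

lemma polyfun_subst:
  assumes "f \<in> polyfun C V" "\<And>v. v \<in> V \<Longrightarrow> (\<lambda>u. s u v) \<in> polyfun C V'"
  shows "(\<lambda>u. f (s u)) \<in> polyfun C V'"
  using assms(1) by induction (use assms in \<open>auto intro: polyfun.intros\<close>)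

lemma polyfun_finite_vars:
  assumes "f \<in> polyfun C V"
  shows "\<exists>V0. finite V0 \<and> V0 \<subseteq> V \<and> f \<in> polyfun C V0"
  using assms
proof induction
  case (const c)
  then show ?case by (intro exI[of _ "{}"]) (auto intro: polyfun.const)
next
  case (var v)
  then show ?case by (intro exI[of _ "{v}"]) (auto intro: polyfun.var)
next
  case (add f g)
  then obtain V1 V2 where "finite V1" "V1 \<subseteq> V" "f \<in> polyfun C V1"
    "finite V2" "V2 \<subseteq> V" "g \<in> polyfun C V2" by blast
  then show ?case
    by (intro exI[of _ "V1 \<union> V2"]) (auto intro!: polyfun.add intro: polyfun_mono)
next
  case (mult f g)
  then obtain V1 V2 where "finite V1" "V1 \<subseteq> V" "f \<in> polyfun C V1"
    "finite V2" "V2 \<subseteq> V" "g \<in> polyfun C V2" by blast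
  then show ?case
    by (intro exI[of _ "V1 \<union> V2"]) (auto intro!: polyfun.mult intro: polyfun_mono)
qed

lemma polyfun_sum:
  assumes "0 \<in> C" "\<And>i. i \<in> I \<Longrightarrow> f i \<in> polyfun C V"
  shows "(\<lambda>w. \<Sum>i\<in>I. f i w) \<in> polyfun C V"
  using assms(2)
  by (induction I rule: infinite_finite_induct) (auto intro: polyfun.intros assms(1))

lemma polyfun_prod:
  assumes "1 \<in> C" "\<And>i. i \<in> I \<Longrightarrow> f i \<in> polyfun C V"
  shows "(\<lambda>w. \<Prod>i\<in>I. f i w) \<in> polyfun C V"
  using assms(2)
  by (induction I rule: infinite_finite_induct) (auto intro: polyfun.intros assms(1))

lemma polyfun_power:
  assumes "1 \<in> C" "f \<in> polyfun C V"
  shows "(\<lambda>w. f w ^ n) \<in> polyfun C V"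
  by (induction n) (auto intro: polyfun.intros assms)

lemma polyfun_diff:
  assumes "-1 \<in> C" "f \<in> polyfun C V" "g \<in> polyfun C V"
  shows "(\<lambda>w. f w - g w) \<in> polyfun C V"
  using polyfun.add[OF assms(2) polyfun.mult[OF polyfun.const[OF assms(1)] assms(3)]] by simp

lemma polyfun_mpoly_eval:
  assumes "range c \<subseteq> C" "0 \<in> C" "1 \<in> C" "mpoly_vars p \<subseteq> V"
  shows "(\<lambda>w. mpoly_eval c w p) \<in> polyfun C V"
  unfolding mpoly_eval_def monom_eval_def
  by (intro polyfun_sum polyfun.mult polyfun_prod polyfun_power polyfun.const polyfun.var)
    (use assms in \<open>auto simp: mpoly_vars_def\<close>)

lemma polyfun_imp_mpoly:
  assumes "f \<in> polyfun UNIV V"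
  shows "\<exists>p. \<forall>w. mpoly_eval (\<lambda>a. a) w p = f w"
  using assms
proof induction
  case (const c)
  show ?case
    by (intro exI[of _ "Poly_Mapping.single 0 c"]) (simp add: mpoly_eval_single monom_eval_def)
next
  case (var v)
  show ?case
    by (intro exI[of _ "Poly_Mapping.single (Poly_Mapping.single v 1) 1"])
      (simp add: mpoly_eval_single monom_eval_def)
next
  case (add f g)
  then show ?case by (metis mpoly_eval_add)
next
  case (mult f g)
  then show ?case by (metis mpoly_eval_mult)
qed

definition entries :: "'a^'n^'m \<Rightarrow> 'm \<times> 'n \<Rightarrow> 'a" where
  "entries A = (\<lambda>(i, j). A $ i $ j)"

lemma entries_apply [simp]: "entries A (i, j) = A $ i $ j"
  by (simp add: entries_def)

lemma zero_locus_entries: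
  "zero_locus P = {A \<in> carrier GL. \<forall>p\<in>P. mpoly_eval (\<lambda>a. a) (entries A) p = 0}"
  by (simp add: zero_locus_def entries_def)

lemma zero_locus_anti_mono: "P \<subseteq> Q \<Longrightarrow> zero_locus Q \<subseteq> zero_locus P"
  by (auto simp: zero_locus_def)

lemma mpoly_eval_ideal:
  assumes "p \<in> ideal_in R P" "\<And>q. q \<in> P \<Longrightarrow> mpoly_eval (\<lambda>a. a) w q = 0"
  shows "mpoly_eval (\<lambda>a. a) w p = 0"
  using assms(1) by induction (auto simp: mpoly_eval_add mpoly_eval_mult assms(2))

text \<open>All of \<open>P\<close> lies in the ideal of a finite part, whose common zeros are
  therefore zeros of \<open>P\<close>. This yields both the descending chain condition and finite
  fields of definition.\<close>

lemma zero_locus_finite: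
  fixes P :: "((('n::finite \<times> 'n) \<Rightarrow>\<^sub>0 nat) \<Rightarrow>\<^sub>0 'k::field) set"
  shows "\<exists>P0. finite P0 \<and> P0 \<subseteq> P \<and> zero_locus P0 = zero_locus P"
proof -
  obtain P0 where P0: "finite P0" "P0 \<subseteq> P" "P \<subseteq> ideal_in UNIV P0"
    using noetherian_set_finite_basis[OF noetherian_mpoly, of P] by blast
  have "zero_locus P0 \<subseteq> zero_locus P"
    unfolding zero_locus_entries using mpoly_eval_ideal[OF subsetD[OF P0(3)]] by auto
  with zero_locus_anti_mono[OF P0(2)] have "zero_locus P0 = zero_locus P" by (rule subset_antisym[rotated])
  with P0(1,2) show ?thesis by (intro exI[of _ P0] conjI)
qed

text \<open>Collect the polynomials that vanish on some member of a descending chain. Finitely many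
  of them cut out the same locus and all vanish from some index \<open>N\<close> on, so the chain
  cannot shrink after \<open>N\<close>.\<close>

lemma wf_zariski:
  "wf {(C, D). closedin zariski C \<and> closedin zariski D \<and> C \<subset> (D :: ('k::field^'n^'n) set)}"
  unfolding wf_iff_no_infinite_down_chain
proof (rule notI, elim exE)
  fix f :: "nat \<Rightarrow> ('k^'n^'n) set"
  assume "\<forall>i. (f (Suc i), f i) \<in> {(C, D). closedin zariski C \<and> closedin zariski D \<and> C \<subset> D}"
  then have f: "\<forall>i. closedin zariski (f (Suc i)) \<and> closedin zariski (f i) \<and> f (Suc i) \<subset> f i" by blast
  define P where "P = {p. \<exists>i. \<forall>A\<in>f i. mpoly_eval (\<lambda>a. a) (entries A) p = 0}"
  obtain P0 where P0: "finite P0" "P0 \<subseteq> P" "zero_locus P0 = (zero_locus P :: ('k^'n^'n) set)"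
    using zero_locus_finite by blast
  have anti: "f j \<subseteq> f i" if "i \<le> j" for i j
    using lift_Suc_antimono_le[of f] f that by blast
  have "\<exists>N. \<forall>p\<in>P0. \<forall>A\<in>f N. mpoly_eval (\<lambda>a. a) (entries A) p = 0"
    using P0(1,2)
  proof (induction P0)
    case (insert p P0)
    then obtain N M where "\<forall>p\<in>P0. \<forall>A\<in>f N. mpoly_eval (\<lambda>a. a) (entries A) p = 0"
      "\<forall>A\<in>f M. mpoly_eval (\<lambda>a. a) (entries A) p = 0" unfolding P_def by blast
    then show ?case using anti[of N "max N M"] anti[of M "max N M"]
      by (intro exI[of _ "max N M"]) auto
  qed auto
  then obtain N where N: "\<forall>p\<in>P0. \<forall>A\<in>f N. mpoly_eval (\<lambda>a. a) (entries A) p = 0" by blast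
  moreover have "f N \<subseteq> carrier GL" using f closedin_subset by fastforce
  ultimately have "f N \<subseteq> zero_locus P0" by (auto simp: zero_locus_entries)
  moreover obtain Q where Q: "f (Suc N) = zero_locus Q"
    using f closedin_zariski by blast
  then have "Q \<subseteq> P" unfolding P_def by (auto simp: zero_locus_entries)
  ultimately have "f N \<subseteq> f (Suc N)"
    using P0(3) Q zero_locus_anti_mono[of Q P] by simp
  then show False using f by blast
qed

section \<open>Irreducible components and homogeneity\<close>

definition irreducible_in :: "'a topology \<Rightarrow> 'a set \<Rightarrow> bool" where
  "irreducible_in T C \<longleftrightarrow> closedin T C \<and> C \<noteq> {} \<and>
    (\<forall>D E. closedin T D \<longrightarrow> closedin T E \<longrightarrow> C \<subseteq> D \<union> E \<longrightarrow> C \<subseteq> D \<or> C \<subseteq> E)"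

lemma irreducible_in_Union:
  assumes "irreducible_in T C" "finite \<C>" "\<And>D. D \<in> \<C> \<Longrightarrow> closedin T D" "C \<subseteq> \<Union>\<C>"
  shows "\<exists>D\<in>\<C>. C \<subseteq> D"
  using assms(2-4)
proof (induction \<C>)
  case empty
  then show ?case using assms(1) by (auto simp: irreducible_in_def)
next
  case (insert D \<C>)
  have "closedin T (\<Union>\<C>)" using insert by (intro closedin_Union) auto
  then have "C \<subseteq> D \<or> C \<subseteq> \<Union>\<C>"
    using assms(1) insert.prems unfolding irreducible_in_def by (metis Union_insert insertI1)
  then show ?case using insert by auto
qed

lemma noetherian_irreducible_decomposition:
  assumes "wf {(C, D). closedin T C \<and> closedin T D \<and> C \<subset> D}" "closedin T C"
  shows "\<exists>\<C>. finite \<C> \<and> (\<forall>D\<in>\<C>. irreducible_in T D) \<and> C = \<Union>\<C>"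
  using assms
proof (induction C rule: wf_induct_rule)
  case (less C)
  consider "C = {}" | "irreducible_in T C" | D E where "closedin T D" "closedin T E" "C \<subseteq> D \<union> E" "\<not> C \<subseteq> D" "\<not> C \<subseteq> E"
    using less.prems unfolding irreducible_in_def by blast
  then show ?case
  proof cases
    case 1
    then show ?thesis by (intro exI[of _ "{}"]) auto
  next
    case 2
    then show ?thesis by (intro exI[of _ "{C}"]) auto
  next
    case 3
    have "closedin T (C \<inter> D)" "closedin T (C \<inter> E)" "C \<inter> D \<subset> C" "C \<inter> E \<subset> C"
      using 3 less.prems by auto
    then obtain \<D> \<E> where
      "finite \<D> \<and> (\<forall>D\<in>\<D>. irreducible_in T D) \<and> C \<inter> D = \<Union>\<D>"
      "finite \<E> \<and> (\<forall>D\<in>\<E>. irreducible_in T D) \<and> C \<inter> E = \<Union>\<E>"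
      using less.IH[of "C \<inter> D"] less.IH[of "C \<inter> E"] less.prems by auto
    moreover from this have "C = \<Union>(\<D> \<union> \<E>)" using 3(3) by blast
    ultimately show ?thesis by (intro exI[of _ "\<D> \<union> \<E>"]) auto
  qed
qed

lemma irreducible_in_image:
  assumes "irreducible_in T C" "homeomorphic_map T T t"
  shows "irreducible_in T (t ` C)"
  unfolding irreducible_in_def
proof (intro conjI allI impI)
  have C: "closedin T C" "C \<subseteq> topspace T"
    using assms(1) closedin_subset by (auto simp: irreducible_in_def)
  then show "closedin T (t ` C)" "t ` C \<noteq> {}"
    using assms homeomorphic_map_closedness[OF assms(2)] by (auto simp: irreducible_in_def)
  fix D E assume DE: "closedin T D" "closedin T E" "t ` C \<subseteq> D \<union> E"
  have t: "continuous_map T T t" using assms(2) homeomorphic_imp_continuous_map by blast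
  let ?D = "{x \<in> topspace T. t x \<in> D}" and ?E = "{x \<in> topspace T. t x \<in> E}"
  have "closedin T ?D" "closedin T ?E" "C \<subseteq> ?D \<union> ?E"
    using closedin_continuous_map_preimage[OF t] DE C by auto
  then have "C \<subseteq> ?D \<or> C \<subseteq> ?E" using assms(1) unfolding irreducible_in_def by blast
  then show "t ` C \<subseteq> D \<or> t ` C \<subseteq> E" by auto
qed

text \<open>
  Some point lies on only one component of an irredundant decomposition; by homogeneity the
  components are then pairwise disjoint, and connectedness leaves only one.
\<close>

theorem connected_homogeneous_irreducible:
  assumes wf: "wf {(C, D). closedin T C \<and> closedin T D \<and> C \<subset> D}"
    and B: "closedin T B" "connectedin T B" "B \<noteq> {}"
    and hom: "\<And>x y. x \<in> B \<Longrightarrow> y \<in> B \<Longrightarrow> \<exists>t. homeomorphic_map T T t \<and> t ` B = B \<and> t x = y"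
  shows "irreducible_in T B"
proof -
  obtain \<C> where C: "finite \<C>" "\<And>D. D \<in> \<C> \<Longrightarrow> irreducible_in T D" "B = \<Union>\<C>"
    using noetherian_irreducible_decomposition[OF wf B(1)] by blast
  \<comment> \<open>Keeping only the maximal pieces makes the decomposition irredundant.\<close>
  define \<M> where "\<M> = {D \<in> \<C>. \<forall>E\<in>\<C>. D \<subseteq> E \<longrightarrow> D = E}"
  have M: "finite \<M>" "\<And>D. D \<in> \<M> \<Longrightarrow> irreducible_in T D" "\<And>D. D \<in> \<M> \<Longrightarrow> closedin T D"
    using C by (auto simp: \<M>_def irreducible_in_def)
  have M_max: "D = E" if "D \<in> \<M>" "E \<in> \<M>" "D \<subseteq> E" for D E
    using that by (auto simp: \<M>_def)
  have "\<exists>E\<in>\<M>. D \<subseteq> E" if "D \<in> \<C>" for D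
    using finite_has_maximal2[OF C(1) that] unfolding \<M>_def by blast
  then have BM: "B = \<Union>\<M>" unfolding C(3) using \<M>_def by blast
  have below: "\<exists>Z\<in>\<M>. D \<subseteq> Z" if "irreducible_in T D" "D \<subseteq> B" for D
    using irreducible_in_Union[OF that(1) M(1,3)] that(2) BM by blast
  obtain D0 where D0: "D0 \<in> \<M>" using B(3) BM by auto
  \<comment> \<open>A component covered by the others would lie in one of them, against maximality.
    So some \<open>x0\<close> lies on \<open>D0\<close> alone.\<close>
  have "\<not> D0 \<subseteq> \<Union>(\<M> - {D0})"
  proof
    assume "D0 \<subseteq> \<Union>(\<M> - {D0})"
    then obtain E where "E \<in> \<M> - {D0}" "D0 \<subseteq> E"
      using irreducible_in_Union[of T D0 "\<M> - {D0}"] M D0 by auto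
    then show False using M_max[OF D0] by blast
  qed
  then obtain x0 where x0: "x0 \<in> D0" "\<And>Z. Z \<in> \<M> \<Longrightarrow> x0 \<in> Z \<Longrightarrow> Z = D0" by blast
  have disj: "D1 = D2" if D: "D1 \<in> \<M>" "D2 \<in> \<M>" "y \<in> D1" "y \<in> D2" for D1 D2 y
  proof -
    have "y \<in> B" "x0 \<in> B" using D BM D0 x0 by auto
    then obtain t where t: "homeomorphic_map T T t" "t ` B = B" "t y = x0" using hom by blast
    then obtain s where s: "homeomorphic_maps T T t s" using homeomorphic_map_maps by blast
    then have ts: "homeomorphic_map T T s" "\<And>x. x \<in> topspace T \<Longrightarrow> s (t x) = x"
      by (auto simp: homeomorphic_maps_map homeomorphic_maps_def)
    have sub: "D \<subseteq> s ` D0" if DM: "D \<in> \<M>" and yD: "y \<in> D" for D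
    proof -
      have "D \<subseteq> B" "D \<subseteq> topspace T" using DM BM M(3) closedin_subset by auto
      then have "t ` D \<subseteq> B" using t(2) by blast
      then obtain Z where "Z \<in> \<M>" "t ` D \<subseteq> Z"
        using below irreducible_in_image[OF M(2)[OF DM] t(1)] by blast
      moreover then have "Z = D0" using x0(2) t(3) yD by auto
      ultimately have "t ` D \<subseteq> D0" by simp
      moreover have "D = s ` t ` D" using ts(2) \<open>D \<subseteq> topspace T\<close> by force
      ultimately show ?thesis by blast
    qed
    have "s ` D0 \<subseteq> B"
    proof -
      have "B \<subseteq> topspace T" using B(1) closedin_subset by blast
      then have "s ` t ` B = B" using ts(2) by force
      then show ?thesis using D0 BM t(2) by auto
    qed
    then obtain Z where "Z \<in> \<M>" "s ` D0 \<subseteq> Z"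
      using below irreducible_in_image[OF M(2)[OF D0] ts(1)] by blast
    then have "D1 = Z" "D2 = Z" using sub D M_max by (meson order_trans)+
    then show ?thesis by simp
  qed
  have "\<M> = {D0}"
  proof (rule ccontr)
    assume "\<M> \<noteq> {D0}"
    then obtain E where E: "E \<in> \<M>" "E \<noteq> D0" using D0 by blast
    have "closedin T (\<Union>(\<M> - {D0}))" using M by (intro closedin_Union) auto
    moreover have "D0 \<inter> \<Union>(\<M> - {D0}) = {}" using disj D0 by blast
    moreover have "B \<subseteq> D0 \<union> \<Union>(\<M> - {D0})" using BM by blast
    moreover have "\<Union>(\<M> - {D0}) \<inter> B \<noteq> {}"
      using E M(2) BM unfolding irreducible_in_def by blast
    moreover have "D0 \<inter> B \<noteq> {}" using D0 x0 BM by blast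
    ultimately show False using B(2) M(3)[OF D0] unfolding connectedin_closedin by blast
  qed
  then show ?thesis using BM M(2)[OF D0] by simp
qed

lemma GL_simps [simp]:
  "monoid.mult GL = (**)" "monoid.one GL = mat 1" "A \<in> carrier GL \<longleftrightarrow> invertible A"
  by (auto simp: GL_def)

lemma polyfun_left_mult:
  fixes C :: "'k::comm_ring_1 set"
  assumes "0 \<in> C" "\<And>i j. y $ i $ j \<in> C"
  shows "(\<lambda>u. (\<Sum>l\<in>UNIV. y $ i $ l * u (l, j))) \<in> polyfun C UNIV"
  by (intro polyfun_sum polyfun.mult polyfun.intros) (use assms in auto)

lemma continuous_map_zariski_left_mult:
  fixes y :: "'k::field^'n^'n"
  assumes "invertible y"
  shows "continuous_map zariski zariski ((**) y)"
  unfolding continuous_map_closedin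
proof (intro conjI allI impI)
  show "(**) y \<in> topspace zariski \<rightarrow> topspace zariski"
    using assms by (auto simp: invertible_mult)
  fix C :: "('k^'n^'n) set" assume "closedin zariski C"
  then obtain P where P: "C = zero_locus P" using closedin_zariski by blast
  let ?s = "\<lambda>u (i, j). \<Sum>l\<in>UNIV. y $ i $ l * u (l, j)"
  have s: "entries (y ** A) = ?s (entries A)" for A :: "'k^'n^'n"
    by (auto simp: fun_eq_iff matrix_matrix_mult_def)
  have "\<forall>p :: ('n \<times> 'n \<Rightarrow>\<^sub>0 nat) \<Rightarrow>\<^sub>0 'k.
      \<exists>q. \<forall>w. mpoly_eval (\<lambda>a. a) w q = mpoly_eval (\<lambda>a. a) (?s w) p"
  proof
    fix p :: "('n \<times> 'n \<Rightarrow>\<^sub>0 nat) \<Rightarrow>\<^sub>0 'k"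
    have "(\<lambda>w. mpoly_eval (\<lambda>a. a) (?s w) p) \<in> polyfun UNIV UNIV"
      by (rule polyfun_subst[OF polyfun_mpoly_eval[of _ UNIV p UNIV]])
        (auto intro!: polyfun_left_mult)
    from polyfun_imp_mpoly[OF this]
    show "\<exists>q. \<forall>w. mpoly_eval (\<lambda>a. a) w q = mpoly_eval (\<lambda>a. a) (?s w) p" .
  qed
  from choice[OF this] obtain q :: "(('n \<times> 'n \<Rightarrow>\<^sub>0 nat) \<Rightarrow>\<^sub>0 'k) \<Rightarrow> ('n \<times> 'n \<Rightarrow>\<^sub>0 nat) \<Rightarrow>\<^sub>0 'k"
    where q: "\<forall>p w. mpoly_eval (\<lambda>a. a) w (q p) = mpoly_eval (\<lambda>a. a) (?s w) p" by blast
  have "{x \<in> topspace zariski. y ** x \<in> C} = zero_locus (q ` P)"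
    unfolding P zero_locus_entries using assms by (auto simp: invertible_mult s q)
  then show "closedin zariski {x \<in> topspace zariski. y ** x \<in> C}"
    using closedin_zariski by blast
qed

lemma homeomorphic_map_zariski_left_mult:
  fixes y :: "'k::field^'n^'n"
  assumes "invertible y"
  shows "homeomorphic_map zariski zariski ((**) y)"
proof -
  obtain z where z: "y ** z = mat 1" "z ** y = mat 1" using assms by (auto simp: invertible_def)
  then have "invertible z" by (auto simp: invertible_def)
  then have "homeomorphic_maps zariski zariski ((**) y) ((**) z)"
    using z assms by (auto simp: homeomorphic_maps_def continuous_map_zariski_left_mult matrix_mul_assoc)
  then show ?thesis using homeomorphic_map_maps by blast
qed

text \<open>Translation by \<open>y\<close> times the inverse of \<open>x\<close> moves
  \<open>x\<close> to \<open>y\<close> and preserves \<open>B\<close>, so \<open>B\<close> is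
  homogeneous and, being connected, irreducible; the zero sets of \<open>f\<close> and
  \<open>g\<close> cover it. Coefficients may come from the whole field.\<close>

theorem connected_group_prime:
  fixes B :: "('k::field^'n^'n) set"
  assumes B: "subgroup B GL" "closedin zariski B" "connectedin zariski B"
    and fg: "f \<in> polyfun UNIV UNIV" "g \<in> polyfun UNIV UNIV"
      "\<And>A. A \<in> B \<Longrightarrow> f (entries A) * g (entries A) = 0"
  shows "(\<forall>A\<in>B. f (entries A) = 0) \<or> (\<forall>A\<in>B. g (entries A) = 0)"
proof -
  interpret GL: group "GL :: ('k^'n^'n) monoid" by (rule group_GL)
  have "irreducible_in zariski B"
  proof (rule connected_homogeneous_irreducible[OF wf_zariski B(2,3)])
    show "B \<noteq> {}" using subgroup.one_closed[OF B(1)] by auto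
    fix x y assume xy: "x \<in> B" "y \<in> B"
    then have GLxy: "x \<in> carrier GL" "y \<in> carrier GL" using subgroup.mem_carrier[OF B(1)] by blast+
    define t where "t = y \<otimes>\<^bsub>GL\<^esub> inv\<^bsub>GL\<^esub> x"
    have t: "t \<in> B" using xy B(1) unfolding t_def by (simp only: subgroup.m_closed subgroup.m_inv_closed)
    then have tG: "t \<in> carrier GL" using subgroup.mem_carrier[OF B(1)] by blast
    have "t \<otimes>\<^bsub>GL\<^esub> x = y"
      by (rule GL.inv_solve_right[THEN iffD1, OF tG GLxy(2,1) t_def, symmetric])
    moreover have "(**) t ` B = B"
    proof
      show "(**) t ` B \<subseteq> B" using t subgroup.m_closed[OF B(1)] by auto
      show "B \<subseteq> (**) t ` B"
      proof
        fix b assume b: "b \<in> B"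
        then have "inv\<^bsub>GL\<^esub> t \<otimes>\<^bsub>GL\<^esub> b \<in> B"
          using t B(1) by (simp only: subgroup.m_closed subgroup.m_inv_closed)
        moreover have "b = t \<otimes>\<^bsub>GL\<^esub> (inv\<^bsub>GL\<^esub> t \<otimes>\<^bsub>GL\<^esub> b)"
          using b by (intro GL.inv_solve_left[THEN iffD1, OF _ _ _ refl] GL.m_closed GL.inv_closed tG
            subgroup.mem_carrier[OF B(1)])
        ultimately show "b \<in> (**) t ` B" by auto
      qed
    qed
    ultimately show "\<exists>t. homeomorphic_map zariski zariski t \<and> t ` B = B \<and> t x = y"
      using tG homeomorphic_map_zariski_left_mult[of t] by (intro exI[of _ "(**) t"]) auto
  qed
  moreover obtain p q where p: "\<And>w. mpoly_eval (\<lambda>a. a) w p = f w"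
    and q: "\<And>w. mpoly_eval (\<lambda>a. a) w q = g w"
    using polyfun_imp_mpoly fg by metis
  moreover have "B \<subseteq> carrier GL" using B(1) subgroup.subset by blast
  moreover then have "B \<subseteq> zero_locus {p} \<union> zero_locus {q}"
    using fg(3) by (auto simp: zero_locus_entries p q)
  moreover have "closedin zariski (zero_locus {p} :: ('k^'n^'n) set)"
    "closedin zariski (zero_locus {q} :: ('k^'n^'n) set)"
    unfolding closedin_zariski by (rule exI, rule refl)+
  ultimately have "B \<subseteq> zero_locus {p} \<or> B \<subseteq> zero_locus {q}"
    unfolding irreducible_in_def by simp
  then show ?thesis by (auto simp: zero_locus_entries p q)
qed

section \<open>Algebraic dependence\<close>

text \<open>The subalgebra over the rationals generated by \<open>A\<close>, whose elements serve as
  their own variables.\<close>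

definition gen :: "'k::field_char_0 set \<Rightarrow> 'k set" where
  "gen A = (\<lambda>f. f (\<lambda>x. x)) ` polyfun \<rat> A"

lemma gen_subring: "subring_set (gen A)"
  unfolding subring_set_def
proof (intro conjI ballI)
  have c: "c \<in> gen A" if "c \<in> \<rat>" for c
    using polyfun.const[OF that, of A] unfolding gen_def by force
  show "0 \<in> gen A" "1 \<in> gen A" by (auto intro: c)
  fix x y assume "x \<in> gen A" "y \<in> gen A"
  then obtain f g where f: "f \<in> polyfun \<rat> A" "x = f (\<lambda>x. x)" and g: "g \<in> polyfun \<rat> A" "y = g (\<lambda>x. x)"
    unfolding gen_def by blast
  show "x + y \<in> gen A" "x * y \<in> gen A"
    unfolding gen_def f(2) g(2)
    by (rule image_eqI[OF _ polyfun.add[OF f(1) g(1)]], simp,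
        rule image_eqI[OF _ polyfun.mult[OF f(1) g(1)]], simp)
next
  fix x assume "x \<in> gen A"
  then obtain f where f: "f \<in> polyfun \<rat> A" "x = f (\<lambda>x. x)" unfolding gen_def by blast
  have "-1 \<in> (\<rat> :: 'a set)" by simp
  from polyfun.mult[OF polyfun.const[OF this, of A] f(1)]
  show "- x \<in> gen A" unfolding gen_def f(2) by (rule image_eqI[rotated]) simp
qed

lemma gen_incl: "A \<subseteq> gen A"
  using polyfun.var[of _ A \<rat>] unfolding gen_def by force

lemma Rats_subset_gen: "\<rat> \<subseteq> gen A"
  using polyfun.const[of _ \<rat> A] unfolding gen_def by force

lemma gen_mono: "A \<subseteq> B \<Longrightarrow> gen A \<subseteq> gen B"
  unfolding gen_def by (rule image_mono) (auto intro: polyfun_mono)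

lemma gen_least:
  assumes "subring_set R" "\<rat> \<subseteq> R" "A \<subseteq> R"
  shows "gen A \<subseteq> R"
proof -
  have "f (\<lambda>x. x) \<in> R" if "f \<in> polyfun \<rat> A" for f
    using that by induction (use assms in \<open>auto intro: subring_setD[OF assms(1)]\<close>)
  then show ?thesis by (auto simp: gen_def)
qed

lemma polyfun_in_gen:
  assumes "f \<in> polyfun \<rat> V"
  shows "f w \<in> gen (w ` V)"
proof -
  have "(\<lambda>u. f (\<lambda>v. u (w v))) \<in> polyfun \<rat> (w ` V)"
    by (rule polyfun_subst[OF assms]) (auto intro: polyfun.var)
  then show ?thesis unfolding gen_def by (rule image_eqI[rotated]) simp
qed

lemma mpoly_eval_of_rat_add:
  fixes w :: "'v \<Rightarrow> 'k::field_char_0"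
  shows "mpoly_eval of_rat w (p + q) = mpoly_eval of_rat w p + mpoly_eval of_rat w q"
proof -
  let ?M = "Poly_Mapping.keys p \<union> Poly_Mapping.keys q"
  have "mpoly_eval of_rat w (p + q) = (\<Sum>m\<in>?M. of_rat (Poly_Mapping.lookup (p + q) m) * monom_eval w m)"
    by (rule mpoly_eval_superset) (use Poly_Mapping.keys_add[of p q] in auto)
  also have "\<dots> = (\<Sum>m\<in>?M. of_rat (Poly_Mapping.lookup p m) * monom_eval w m) +
      (\<Sum>m\<in>?M. of_rat (Poly_Mapping.lookup q m) * monom_eval w m)"
    by (simp add: lookup_add of_rat_add distrib_right sum.distrib)
  also have "\<dots> = mpoly_eval of_rat w p + mpoly_eval of_rat w q"
    by (simp add: mpoly_eval_superset[of ?M p] mpoly_eval_superset[of ?M q])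
  finally show ?thesis .
qed

lemma mpoly_eval_of_rat_mult:
  fixes w :: "'v \<Rightarrow> 'k::field_char_0"
  shows "mpoly_eval of_rat w (p * q) = mpoly_eval of_rat w p * mpoly_eval of_rat w q"
proof (induction p rule: mpoly_induct)
  case (single m a)
  show ?case
  proof (induction q rule: mpoly_induct)
    case (single n b)
    show ?case
      by (simp add: mult_single mpoly_eval_single monom_eval_add of_rat_mult mult_ac)
  qed (simp_all add: mpoly_eval_of_rat_add distrib_left)
qed (simp_all add: mpoly_eval_of_rat_add distrib_right)

lemma polyfun_Rats_imp_mpoly:
  fixes f :: "('v \<Rightarrow> 'k::field_char_0) \<Rightarrow> 'k"
  assumes "f \<in> polyfun \<rat> V"
  shows "\<exists>p. mpoly_vars p \<subseteq> V \<and> (\<forall>w. mpoly_eval of_rat w p = f w)"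
  using assms
proof induction
  case (const c)
  then obtain q where "c = of_rat q" by (rule Rats_cases)
  then show ?case
    by (intro exI[of _ "Poly_Mapping.single 0 q"])
      (auto simp: mpoly_eval_single monom_eval_def mpoly_vars_def)
next
  case (var v)
  then show ?case
    by (intro exI[of _ "Poly_Mapping.single (Poly_Mapping.single v 1) 1"])
      (auto simp: mpoly_eval_single monom_eval_def mpoly_vars_def)
next
  case (add f g)
  then obtain p q where pq: "mpoly_vars p \<subseteq> V" "\<forall>w. mpoly_eval of_rat w p = f w"
    "mpoly_vars q \<subseteq> V" "\<forall>w. mpoly_eval of_rat w q = g w" by blast
  have "mpoly_vars (p + q) \<subseteq> mpoly_vars p \<union> mpoly_vars q"
    using Poly_Mapping.keys_add[of p q] unfolding mpoly_vars_def by blast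
  with pq show ?case by (intro exI[of _ "p + q"]) (auto simp: mpoly_eval_of_rat_add)
next
  case (mult f g)
  then obtain p q where pq: "mpoly_vars p \<subseteq> V" "\<forall>w. mpoly_eval of_rat w p = f w"
    "mpoly_vars q \<subseteq> V" "\<forall>w. mpoly_eval of_rat w q = g w" by blast
  have "mpoly_vars (p * q) \<subseteq> mpoly_vars p \<union> mpoly_vars q"
  proof
    fix v assume "v \<in> mpoly_vars (p * q)"
    then obtain m where m: "m \<in> Poly_Mapping.keys (p * q)" "v \<in> Poly_Mapping.keys m"
      unfolding mpoly_vars_def by blast
    then obtain a b where "m = a + b" "a \<in> Poly_Mapping.keys p" "b \<in> Poly_Mapping.keys q"
      using Poly_Mapping.keys_mult[of p q] by blast
    then show "v \<in> mpoly_vars p \<union> mpoly_vars q"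
      using m(2) Poly_Mapping.keys_add[of a b] unfolding mpoly_vars_def by blast
  qed
  with pq show ?case by (intro exI[of _ "p * q"]) (auto simp: mpoly_eval_of_rat_mult)
qed

text \<open>Independence makes a relation among elements of \<open>S\<close> a formal identity, so
  the elements may be replaced by arbitrary values.\<close>

lemma algebraically_independent_polyfun:
  assumes "algebraically_independent S" "f \<in> polyfun \<rat> S" "f (\<lambda>x. x) = 0"
  shows "f w = 0"
proof -
  obtain p where p: "mpoly_vars p \<subseteq> S" "\<forall>w. mpoly_eval of_rat w p = f w"
    using polyfun_Rats_imp_mpoly[OF assms(2)] by blast
  then have "p = 0" using assms(1,3) unfolding algebraically_independent_def by metis
  then show ?thesis using p(2) by (metis mpoly_eval_0)
qed

text \<open>\<open>P\<close> need not be monic: over a ring this is algebraicity over the fraction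
  field, not integrality.\<close>

definition alg_over :: "'k::field set \<Rightarrow> 'k \<Rightarrow> bool" where
  "alg_over R x \<longleftrightarrow> (\<exists>P. P \<noteq> 0 \<and> (\<forall>i. coeff P i \<in> R) \<and> poly P x = 0)"

lemma alg_over_mono: "alg_over R x \<Longrightarrow> R \<subseteq> R' \<Longrightarrow> alg_over R' x"
  unfolding alg_over_def by blast

text \<open>For \<open>a\<close> outside \<open>S\<close>, maximality gives a relation that involves
  \<open>a\<close>; read as a polynomial in \<open>a\<close>, it stays nonzero because its
  coefficients are evaluated at independent elements. A relation mentions only finitely many
  elements of \<open>S\<close>.\<close>

lemma transcendence_basis_alg_over:
  assumes "transcendence_basis S"
  shows "\<exists>S0. finite S0 \<and> S0 \<subseteq> S \<and> alg_over (gen S0) a"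
proof (cases "a \<in> S")
  case True
  have "coeff [:- a, 1:] i \<in> gen {a}" for i
    using gen_incl[of "{a}"] by (auto simp: coeff_pCons subring_setD[OF gen_subring] split: nat.split)
  moreover have "poly [:- a, 1:] a = 0" "[:- a, 1:] \<noteq> 0" by auto
  ultimately show ?thesis using True unfolding alg_over_def by (intro exI[of _ "{a}"]) blast
next
  case False
  then have "\<not> algebraically_independent (insert a S)"
    using assms unfolding transcendence_basis_def by blast
  then obtain p :: "('a \<Rightarrow>\<^sub>0 nat) \<Rightarrow>\<^sub>0 rat" where
    p: "mpoly_vars p \<subseteq> insert a S" "mpoly_eval of_rat (\<lambda>s. s) p = 0" "p \<noteq> 0"
    unfolding algebraically_independent_def by blast
  let ?V = "mpoly_vars p - {a}"
  let ?X = "Poly_Mapping.single (Poly_Mapping.single a 1) (1::rat)"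
  let ?ev = "mpoly_eval of_rat (\<lambda>s. s) :: (('a \<Rightarrow>\<^sub>0 nat) \<Rightarrow>\<^sub>0 rat) \<Rightarrow> 'a"
  obtain Q where Q: "\<forall>i. mpoly_vars (coeff Q i) \<subseteq> ?V" "p = poly Q ?X"
    using mpoly_as_poly[of p a ?V] by blast
  define P where "P = map_poly ?ev Q"
  have cP: "coeff P i = ?ev (coeff Q i)" for i by (simp add: P_def coeff_map_poly)
  have "Q \<noteq> 0" using p(3) Q(2) by auto
  then obtain i where i: "coeff Q i \<noteq> 0" by (auto simp: poly_eq_iff)
  have "mpoly_vars (coeff Q i) \<subseteq> S" using Q(1) p(1) by blast
  then have "coeff P i \<noteq> 0"
    using i assms unfolding cP transcendence_basis_def algebraically_independent_def by blast
  then have "P \<noteq> 0" by auto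
  moreover have "coeff P i \<in> gen ?V" for i
  proof -
    have "(\<lambda>w. mpoly_eval of_rat w (coeff Q i)) \<in> polyfun \<rat> ?V"
      using Q(1) by (intro polyfun_mpoly_eval) auto
    then show ?thesis unfolding cP gen_def by (rule image_eqI[rotated]) simp
  qed
  moreover have "poly P a = 0"
  proof -
    have "poly (map_poly ?ev R) a = ?ev (poly R ?X)" for R
    proof (induction R)
      case (pCons c R)
      have "?ev ?X = a" by (simp add: mpoly_eval_single monom_eval_def)
      with pCons show ?case
        by (simp add: map_poly_pCons mpoly_eval_of_rat_add mpoly_eval_of_rat_mult)
    qed simp
    then show ?thesis using p(2) Q(2) by (simp add: P_def)
  qed
  ultimately have "alg_over (gen ?V) a" unfolding alg_over_def by blast
  moreover have "finite ?V" by (auto simp: mpoly_vars_def)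
  ultimately show ?thesis using p(1) by (intro exI[of _ ?V]) auto
qed

lemma independent_not_alg_over:
  assumes "algebraically_independent S" "S0 \<subseteq> S" "d \<in> S" "d \<notin> S0"
  shows "\<not> alg_over (gen S0) d"
proof
  assume "alg_over (gen S0) d"
  then obtain P where P: "P \<noteq> 0" "\<forall>i. coeff P i \<in> gen S0" "poly P d = 0"
    unfolding alg_over_def by blast
  have "\<forall>i. \<exists>f. f \<in> polyfun \<rat> S0 \<and> coeff P i = f (\<lambda>x. x)"
    using P(2) unfolding gen_def by blast
  from choice[OF this] obtain f where
    f: "\<And>i. f i \<in> polyfun \<rat> S0" "\<And>i. coeff P i = f i (\<lambda>x. x)" by blast
  define F where "F w = (\<Sum>i\<le>degree P. f i w * w d ^ i)" for w :: "'a \<Rightarrow> 'a"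
  have "F \<in> polyfun \<rat> S"
    unfolding F_def using assms(2,3) f(1)
    by (intro polyfun_sum polyfun.mult polyfun_power polyfun.var) (auto intro: polyfun_mono)
  moreover have "F (\<lambda>x. x) = poly P d" by (simp add: F_def poly_altdef f(2))
  ultimately have F0: "F w = 0" for w
    using algebraically_independent_polyfun[OF assms(1)] P(3) by simp
  \<comment> \<open>Since \<open>d\<close> is not in \<open>S0\<close>, moving its value to
    \<open>t\<close> leaves the coefficients alone. So \<open>P\<close> vanishes everywhere, which
    over an infinite field means \<open>P = 0\<close>.\<close>
  have "poly P t = 0" for t
  proof -
    have "f i ((\<lambda>x. x)(d := t)) = coeff P i" for i
      unfolding f(2) using assms(4) by (intro polyfun_cong[OF f(1)]) auto
    then have "F ((\<lambda>x. x)(d := t)) = poly P t" by (simp add: F_def poly_altdef)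
    then show ?thesis using F0 by simp
  qed
  then have "P = 0" using poly_all_0_iff_0[of P] by blast
  with P(1) show False by simp
qed

section \<open>Transitivity of algebraic dependence through finite field extensions\<close>

definition field_record :: "'k::field ring" where
  "field_record = \<lparr>carrier = UNIV, monoid.mult = (*), one = 1, ring.zero = 0, add = (+)\<rparr>"

lemma field_record_simps [simp]:
  "carrier field_record = UNIV" "monoid.mult field_record = (*)" "one field_record = 1"
  "ring.zero field_record = 0" "add field_record = (+)"
  by (auto simp: field_record_def)

lemma field_field_record: "Ring.field (field_record :: 'k::field ring)"
proof -
  have "\<exists>y. x + y = 0" for x :: 'k using add.right_inverse by blast
  moreover have "x \<noteq> 0 \<Longrightarrow> \<exists>y. x * y = 1" for x :: 'k by (rule exI[of _ "inverse x"]) auto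
  ultimately show ?thesis
    unfolding field_record_def using add.right_inverse
    by unfold_locales (auto simp: algebra_simps Units_def)
qed

interpretation fr: domain "field_record :: 'k::field ring"
  using field_field_record by (rule Ring.field.axioms(1))

lemma field_record_a_inv [simp]: "a_inv field_record x = - (x :: 'k::field)"
  using fr.add.inv_equality[of "- x" x] by (simp add: a_inv_def)

lemma field_record_m_inv: "x \<noteq> 0 \<Longrightarrow> m_inv field_record x = inverse (x :: 'k::field)"
  using fr.comm_inv_char[of x "inverse x"] by simp

lemma field_record_pow [simp]: "x [^]\<^bsub>field_record\<^esub> n = (x :: 'k::field) ^ (n::nat)"
  by (induction n) (auto simp: mult.commute)

text \<open>Coefficient lists of \<open>univ_poly\<close> start with the leading coefficient, those
  of \<open>Poly\<close> with the constant one, hence \<open>rev\<close>.\<close>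

lemma field_record_eval: "fr.eval p x = poly (Poly (rev p)) x"
  by (induction p) (auto simp: Poly_append poly_monom mult.commute)

lemma algebraic_imp_alg_over:
  assumes "subfield K field_record" "(fr.algebraic over K) x"
  shows "alg_over K x"
proof -
  have sub: "subring K field_record" using assms(1) by (rule subfieldE(1))
  obtain p where p: "p \<in> carrier (univ_poly field_record K)" "p \<noteq> []" "fr.eval p x = 0"
    using fr.algebraicE[OF sub _ assms(2)] by auto
  then have pK: "set p \<subseteq> K" "hd p \<noteq> 0"
    by (auto simp: univ_poly_def polynomial_def)
  have "coeff (Poly (rev p)) (length p - 1) \<noteq> 0"
    using p(2) pK(2) by (simp add: nth_default_def rev_nth hd_conv_nth)
  then have "Poly (rev p) \<noteq> 0" by (metis coeff_0)
  moreover have "coeff (Poly (rev p)) i \<in> K" for i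
    using pK(1) subringE(2)[OF sub] by (auto simp: nth_default_def rev_nth)
  ultimately show ?thesis using p(3) unfolding alg_over_def field_record_eval by blast
qed

lemma alg_over_imp_algebraic:
  assumes "alg_over K x"
  shows "(fr.algebraic over K) x"
proof -
  obtain P where P: "P \<noteq> 0" "\<forall>i. coeff P i \<in> K" "poly P x = 0"
    using assms unfolding alg_over_def by blast
  show ?thesis
  proof (rule fr.algebraicI)
    show "rev (coeffs P) \<noteq> []" using P(1) by simp
    show "fr.eval (rev (coeffs P)) x = \<zero>\<^bsub>field_record\<^esub>" using P(3) by (simp add: field_record_eval)
    have "hd (rev (coeffs P)) \<noteq> 0" using P(1) by (simp add: hd_rev last_coeffs_eq_coeff_degree)
    moreover have "set (rev (coeffs P)) \<subseteq> K" using P(2) by (auto simp: coeffs_def)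
    ultimately show "rev (coeffs P) \<in> carrier (univ_poly field_record K)"
      by (auto simp: univ_poly_def polynomial_def)
  qed
qed

definition fractions :: "'k::field set \<Rightarrow> 'k set" where
  "fractions R = {x / y |x y. x \<in> R \<and> y \<in> R \<and> y \<noteq> 0}"

lemma fractions_incl: "subring_set R \<Longrightarrow> R \<subseteq> fractions R"
proof
  fix x assume "subring_set R" "x \<in> R"
  then show "x \<in> fractions R"
    using subring_setD(2) unfolding fractions_def
    by (intro CollectI exI[of _ x] exI[of _ 1]) auto
qed

lemma subfield_fractions:
  assumes "subring_set R"
  shows "subfield (fractions R) field_record"
proof -
  note R = subring_setD[OF assms]
  have I: "x / y \<in> fractions R" if "x \<in> R" "y \<in> R" "y \<noteq> 0" for x y
    using that unfolding fractions_def by blast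
  show ?thesis
  proof (rule field.subfieldI'[OF field_field_record])
    show "subring (fractions R) field_record"
    proof (rule fr.subringI)
      show "fractions R \<subseteq> carrier field_record" by simp
      show "\<one>\<^bsub>field_record\<^esub> \<in> fractions R" using I[OF R(2) R(2)] by simp
      fix x assume "x \<in> fractions R"
      then obtain a b where ab: "x = a / b" "a \<in> R" "b \<in> R" "b \<noteq> 0" unfolding fractions_def by blast
      show "\<ominus>\<^bsub>field_record\<^esub> x \<in> fractions R"
        using I[OF R(3)[OF ab(2)] ab(3,4)] ab(1) by simp
      fix y assume "y \<in> fractions R"
      then obtain c d where cd: "y = c / d" "c \<in> R" "d \<in> R" "d \<noteq> 0" unfolding fractions_def by blast
      show "x \<oplus>\<^bsub>field_record\<^esub> y \<in> fractions R"
        using I[of "a * d + c * b" "b * d"] ab cd R by (simp add: add_frac_eq)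
      show "x \<otimes>\<^bsub>field_record\<^esub> y \<in> fractions R"
        using I[of "a * c" "b * d"] ab cd R by simp
    qed
    fix k assume "k \<in> fractions R - {\<zero>\<^bsub>field_record\<^esub>}"
    then obtain a b where ab: "k = a / b" "a \<in> R" "b \<in> R" "b \<noteq> 0" "k \<noteq> 0" unfolding fractions_def by auto
    then show "inv\<^bsub>field_record\<^esub> k \<in> fractions R"
      using I[of b a] by (simp add: field_record_m_inv)
  qed
qed

lemma common_denominator:
  assumes "subring_set R" "finite C" "C \<subseteq> fractions R"
  shows "\<exists>y\<in>R. y \<noteq> 0 \<and> (\<forall>c\<in>C. y * c \<in> R)"
  using assms(2,3)
proof induction
  case empty
  then show ?case using subring_setD(2)[OF assms(1)] by (intro bexI[of _ 1]) auto
next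
  case (insert c C)
  then obtain y where y: "y \<in> R" "y \<noteq> 0" "\<forall>c\<in>C. y * c \<in> R" by auto
  obtain a b where ab: "c = a / b" "a \<in> R" "b \<in> R" "b \<noteq> 0"
    using insert.prems unfolding fractions_def by blast
  have "b * y * c' \<in> R" if "c' \<in> insert c C" for c'
  proof (cases "c' = c")
    case True
    then have eq: "b * y * c' = y * a" using ab by simp
    show ?thesis unfolding eq by (rule subring_setD(6)[OF assms(1) y(1) ab(2)])
  next
    case False
    then show ?thesis using that y ab subring_setD(6)[OF assms(1), of b "y * c'"]
      by (auto simp: mult.assoc)
  qed
  then show ?case using y ab subring_setD(6)[OF assms(1), of b y] by (intro bexI[of _ "b * y"]) auto
qed

lemma alg_over_fractions:
  assumes "subring_set R" "alg_over (fractions R) x"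
  shows "alg_over R x"
proof -
  obtain P where P: "P \<noteq> 0" "\<forall>i. coeff P i \<in> fractions R" "poly P x = 0"
    using assms(2) unfolding alg_over_def by blast
  have "finite (coeff P ` {..degree P})" "coeff P ` {..degree P} \<subseteq> fractions R" using P(2) by auto
  from common_denominator[OF assms(1) this]
  obtain y where y: "y \<in> R" "y \<noteq> 0" "\<forall>i\<le>degree P. y * coeff P i \<in> R" by auto
  have "coeff (smult y P) i \<in> R" for i
    using y(3) subring_setD(1)[OF assms(1)] by (cases "i \<le> degree P") (auto simp: coeff_eq_0)
  moreover have "smult y P \<noteq> 0" "poly (smult y P) x = 0" using y P by auto
  ultimately show ?thesis unfolding alg_over_def by blast
qed

text \<open>Adjoining the finitely many elements of \<open>A\<close> to the fraction field of
  \<open>R\<close>, and then \<open>d\<close>, gives a tower of finite-dimensional extensions, so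
  \<open>d\<close> is algebraic over the bottom. Clearing denominators returns from fractions to
  \<open>R\<close>.\<close>

theorem alg_over_trans:
  assumes R: "subring_set R" "\<rat> \<subseteq> R" and A: "finite A" "\<And>a. a \<in> A \<Longrightarrow> alg_over R a"
    and d: "alg_over (gen A) d"
  shows "alg_over R d"
proof -
  let ?K = "fractions R"
  note K = subfield_fractions[OF R(1)]
  obtain xs where xs: "set xs = A" using A(1) finite_list by blast
  let ?E = "fr.finite_extension ?K xs"
  have alg: "(fr.algebraic over ?K) a" if "a \<in> set xs" for a
    using alg_over_imp_algebraic[OF alg_over_mono[OF A(2) fractions_incl[OF R(1)]]] that xs by blast
  have E: "subfield ?E field_record" "fr.finite_dimension ?K ?E"
    using fr.finite_extension_is_subfield[OF K _ alg] fr.finite_extension_finite_dimension(1)[OF K _ alg]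
    by auto
  have "subring_set ?E"
    using subringE[OF subfieldE(1)[OF E(1)]] unfolding subring_set_def by auto
  moreover have "\<rat> \<subseteq> ?E"
    using R(2) fractions_incl[OF R(1)] fr.finite_extension_incl[of ?K xs] by auto
  moreover have "A \<subseteq> ?E" using fr.finite_extension_mem[OF subfieldE(1)[OF K], of xs] xs by auto
  ultimately have "gen A \<subseteq> ?E" by (rule gen_least)
  then have "(fr.algebraic over ?E) d" using alg_over_imp_algebraic alg_over_mono d by blast
  then have "fr.finite_dimension ?E (fr.simple_extension ?E d)"
    using fr.finite_dimension_simple_extension[OF E(1)] by auto
  then have "fr.finite_dimension ?K (fr.simple_extension ?E d)"
    by (rule fr.telescopic_base_dim(1)[OF K E])
  then have "(fr.algebraic over ?K) d"
    using fr.finite_dimension_imp_algebraic[OF K fr.simple_extension_is_subring[OF subfieldE(1)[OF E(1)]]]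
      fr.simple_extension_mem[OF subfieldE(1)[OF E(1)]] by auto
  then show ?thesis using algebraic_imp_alg_over[OF K] alg_over_fractions[OF R(1)] by blast
qed

text \<open>The elements of \<open>A\<close> are algebraic over a finite part of \<open>S\<close>.
  An element of \<open>S\<close> outside this part works: were it algebraic over
  \<open>gen A\<close>, it would by transitivity depend on that part.\<close>

theorem exists_transcendental:
  fixes S A :: "'k::field_char_0 set"
  assumes "transcendence_basis S" "infinite S" "finite A"
  shows "\<exists>d. \<not> alg_over (gen A) d"
proof -
  have "\<forall>a. \<exists>S0. finite S0 \<and> S0 \<subseteq> S \<and> alg_over (gen S0) a"
    by (rule allI transcendence_basis_alg_over[OF assms(1)])+
  from choice[OF this] obtain s where s: "\<And>a. finite (s a) \<and> s a \<subseteq> S \<and> alg_over (gen (s a)) a" by blast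
  let ?S0 = "\<Union>a\<in>A. s a"
  have "finite ?S0" "?S0 \<subseteq> S" using s assms(3) by auto
  then obtain d where d: "d \<in> S" "d \<notin> ?S0"
    using assms(2) by (metis finite_subset subsetI)
  have "alg_over (gen ?S0) a" if "a \<in> A" for a
    using s[of a] that alg_over_mono[OF _ gen_mono[of "s a" ?S0]] by blast
  then have "\<not> alg_over (gen A) d"
    using alg_over_trans[OF gen_subring Rats_subset_gen assms(3)]
      independent_not_alg_over[OF _ \<open>?S0 \<subseteq> S\<close> d] assms(1)
    unfolding transcendence_basis_def by blast
  then show ?thesis by blast
qed

section \<open>Countability of the field\<close>

datatype polyexpr = Const rat | Var nat | Add polyexpr polyexpr | Mult polyexpr polyexpr

instance polyexpr :: countable by countable_datatype

primrec polyexpr_eval :: "(nat \<Rightarrow> 'k::field_char_0) \<Rightarrow> polyexpr \<Rightarrow> 'k" where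
  "polyexpr_eval s (Const c) = of_rat c"
| "polyexpr_eval s (Var n) = s n"
| "polyexpr_eval s (Add p q) = polyexpr_eval s p + polyexpr_eval s q"
| "polyexpr_eval s (Mult p q) = polyexpr_eval s p * polyexpr_eval s q"

lemma countable_gen:
  assumes "countable S"
  shows "countable (gen S)"
proof -
  let ?e = "polyexpr_eval (from_nat_into S)"
  define i :: "'a \<Rightarrow> 'a" where "i = (\<lambda>x. x)"
  have ex: "\<exists>p. ?e p = f i" if "f \<in> polyfun \<rat> S" for f
    using that
  proof induction
    case (const c)
    then obtain q where "c = of_rat q" by (rule Rats_cases)
    then show ?case by (intro exI[of _ "Const q"]) simp
  next
    case (var v)
    then show ?case using assms by (intro exI[of _ "Var (to_nat_on S v)"]) (simp add: i_def)
  next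
    case (add f g)
    then obtain p q where "?e p = f i" "?e q = g i" by blast
    then show ?case by (intro exI[of _ "Add p q"]) simp
  next
    case (mult f g)
    then obtain p q where "?e p = f i" "?e q = g i" by blast
    then show ?case by (intro exI[of _ "Mult p q"]) simp
  qed
  have "gen S \<subseteq> range ?e" unfolding gen_def i_def[symmetric]
  proof (rule image_subsetI)
    fix f :: "('a \<Rightarrow> 'a) \<Rightarrow> 'a" assume "f \<in> polyfun \<rat> S"
    from ex[OF this] obtain p where "?e p = f i" ..
    from this[symmetric] show "f i \<in> range ?e" by simp
  qed
  then show ?thesis by (rule countable_subset) simp
qed

text \<open>Every element is a root of one of countably many nonzero polynomials over
  \<open>gen S\<close>, and each of these has finitely many roots.\<close>

theorem countable_field:
  fixes S :: "'k::field_char_0 set"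
  assumes "transcendence_basis S" "countable S"
  shows "countable (UNIV :: 'k set)"
proof -
  let ?P = "{P :: 'k poly. P \<noteq> 0 \<and> (\<forall>i. coeff P i \<in> gen S)}"
  have "?P \<subseteq> Poly ` lists (gen S)"
  proof
    fix P :: "'k poly" assume "P \<in> ?P"
    then have "coeffs P \<in> lists (gen S)" by (auto simp: coeffs_def)
    then show "P \<in> Poly ` lists (gen S)" by (metis Poly_coeffs imageI)
  qed
  then have "countable ?P"
    by (rule countable_subset[OF _ countable_image[OF countable_lists[OF countable_gen[OF assms(2)]]]])
  then have cnt: "countable (\<Union>P\<in>?P. {x. poly P x = 0})"
    by (rule countable_UN) (auto intro!: countable_finite poly_roots_finite)
  have mem: "x \<in> (\<Union>P\<in>?P. {x. poly P x = 0})" for x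
  proof -
    obtain S0 where "S0 \<subseteq> S" "alg_over (gen S0) x"
      using transcendence_basis_alg_over[OF assms(1)] by blast
    then have "alg_over (gen S) x" using alg_over_mono gen_mono by blast
    then show ?thesis unfolding alg_over_def by blast
  qed
  show ?thesis by (rule countable_subset[OF _ cnt]) (rule subsetI, rule mem)
qed

section \<open>Extending specialisations\<close>

text \<open>
  A polynomial over the ring of polynomial functions is represented by its specialisations at all
  valuations, so that arithmetic takes place in the integral domain \<^typ>\<open>'k poly\<close>.
\<close>

definition upoly :: "'v set \<Rightarrow> nat \<Rightarrow> (('v \<Rightarrow> 'k::field_char_0) \<Rightarrow> 'k poly) set" where
  "upoly V N = {F. (\<forall>i. (\<lambda>w. coeff (F w) i) \<in> polyfun \<rat> V) \<and> (\<forall>w. degree (F w) \<le> N)}"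

lemma polyfun_Rats_simps:
  "(\<lambda>_. 0) \<in> polyfun \<rat> V" "(\<lambda>_. 1) \<in> polyfun \<rat> V"
  "f \<in> polyfun \<rat> V \<Longrightarrow> g \<in> polyfun \<rat> V \<Longrightarrow> (\<lambda>w. f w - g w) \<in> polyfun \<rat> V"
  "f \<in> polyfun \<rat> V \<Longrightarrow> (\<lambda>w. f w ^ n) \<in> polyfun \<rat> V"
  by (auto intro: polyfun.const polyfun_diff polyfun_power)

lemma upoly_coeff: "F \<in> upoly V N \<Longrightarrow> (\<lambda>w. coeff (F w) i) \<in> polyfun \<rat> V"
  by (simp add: upoly_def)

lemma upoly_degree: "F \<in> upoly V N \<Longrightarrow> degree (F w) \<le> N"
  by (simp add: upoly_def)

lemma upoly_mono: "F \<in> upoly V N \<Longrightarrow> N \<le> M \<Longrightarrow> F \<in> upoly V M"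
  unfolding upoly_def using order_trans by blast

lemma upoly_monom: "f \<in> polyfun \<rat> V \<Longrightarrow> (\<lambda>w. monom (f w) n) \<in> upoly V n"
proof -
  assume f: "f \<in> polyfun \<rat> V"
  have "(\<lambda>w. coeff (monom (f w) n) i) \<in> polyfun \<rat> V" for i
    by (cases "n = i") (auto simp: f polyfun_Rats_simps)
  then show ?thesis unfolding upoly_def by (auto simp: degree_monom_le)
qed

lemma upoly_add: "F \<in> upoly V N \<Longrightarrow> G \<in> upoly V N \<Longrightarrow> (\<lambda>w. F w + G w) \<in> upoly V N"
  unfolding upoly_def by (auto intro: polyfun.add degree_add_le)

lemma upoly_diff: "F \<in> upoly V N \<Longrightarrow> G \<in> upoly V N \<Longrightarrow> (\<lambda>w. F w - G w) \<in> upoly V N"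
  unfolding upoly_def by (auto intro: polyfun_Rats_simps degree_diff_le)

lemma upoly_mult:
  assumes "F \<in> upoly V N" "G \<in> upoly V M"
  shows "(\<lambda>w. F w * G w) \<in> upoly V (N + M)"
  unfolding upoly_def
proof (intro CollectI conjI allI)
  show "degree (F w * G w) \<le> N + M" for w
    using upoly_degree[OF assms(1), of w] upoly_degree[OF assms(2), of w] degree_mult_le[of "F w" "G w"]
    by linarith
  show "(\<lambda>w. coeff (F w * G w) i) \<in> polyfun \<rat> V" for i
    unfolding coeff_mult using assms by (intro polyfun_sum polyfun.mult upoly_coeff) auto
qed

lemma upoly_smult:
  assumes "f \<in> polyfun \<rat> V" "F \<in> upoly V N"
  shows "(\<lambda>w. smult (f w) (F w)) \<in> upoly V N"
  using assms unfolding upoly_def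
  by (auto intro: polyfun.mult order_trans[OF degree_smult_le])

lemma upoly_lower:
  assumes "F \<in> upoly V N" "\<And>w. coeff (F w) N = 0" "N > 0"
  shows "F \<in> upoly V (N - 1)"
proof -
  have "degree (F w) \<le> N - 1" for w
  proof (rule degree_le, intro allI impI)
    fix i assume "i > N - 1"
    then consider "i = N" | "i > N" by linarith
    then show "coeff (F w) i = 0"
      by cases (use assms(2) upoly_degree[OF assms(1), of w] in \<open>auto intro: coeff_eq_0\<close>)
  qed
  then show ?thesis using assms(1) by (simp add: upoly_def)
qed

lemma upoly_eval:
  assumes "F \<in> upoly V N"
  shows "(\<lambda>w. poly (F w) (w y)) \<in> polyfun \<rat> (insert y V)"
proof -
  have "poly (F w) (w y) = (\<Sum>i\<le>N. coeff (F w) i * w y ^ i)" for w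
    using arg_cong[OF poly_as_sum_of_monoms'[OF upoly_degree[OF assms], of w], of "\<lambda>p. poly p (w y)"]
    by (simp add: poly_sum poly_monom)
  then show ?thesis
    using upoly_coeff[OF assms]
    by (auto intro!: polyfun_sum polyfun.mult polyfun_Rats_simps(4) polyfun.var intro: polyfun_mono)
qed

lemma polyfun_insert_upoly:
  assumes "f \<in> polyfun \<rat> (insert y V)"
  shows "\<exists>F N. F \<in> upoly V N \<and> (\<forall>w. f w = poly (F w) (w y))"
  using assms
proof induction
  case (const c)
  then show ?case
    using upoly_monom[OF polyfun.const[OF const, of V], of 0]
    by (intro exI[of _ "\<lambda>_. monom c 0"] exI[of _ 0]) (auto simp: poly_monom)
next
  case (var v)
  then show ?case
  proof
    assume "v = y"
    then show ?thesis
      using upoly_monom[OF polyfun_Rats_simps(2)[of V], of 1]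
      by (intro exI[of _ "\<lambda>_. monom 1 1"] exI[of _ 1]) (auto simp: poly_monom)
  next
    assume "v \<in> V"
    then show ?thesis
      using upoly_monom[OF polyfun.var[of v V \<rat>], of 0]
      by (intro exI[of _ "\<lambda>w. monom (w v) 0"] exI[of _ 0]) (auto simp: poly_monom)
  qed
next
  case (add f g)
  then obtain F N G M where "F \<in> upoly V N" "G \<in> upoly V M"
    "\<forall>w. f w = poly (F w) (w y)" "\<forall>w. g w = poly (G w) (w y)" by blast
  then show ?case
    using upoly_add[OF upoly_mono[of F V N "max N M"] upoly_mono[of G V M "max N M"]]
    by (intro exI[of _ "\<lambda>w. F w + G w"] exI[of _ "max N M"]) auto
next
  case (mult f g)
  then obtain F N G M where "F \<in> upoly V N" "G \<in> upoly V M"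
    "\<forall>w. f w = poly (F w) (w y)" "\<forall>w. g w = poly (G w) (w y)" by blast
  then show ?case
    using upoly_mult[of F V N G M]
    by (intro exI[of _ "\<lambda>w. F w * G w"] exI[of _ "N + M"]) auto
qed

lemma upoly_cong:
  assumes "F \<in> upoly V N" "\<And>v. v \<in> V \<Longrightarrow> w v = w' v"
  shows "F w = F w'"
proof (rule poly_eqI)
  show "coeff (F w) i = coeff (F w') i" for i
    using polyfun_cong[OF upoly_coeff[OF assms(1)] assms(2)] .
qed

text \<open>Coefficients cannot be inverted, so each reduction first multiplies by the formal
  leading coefficient of \<open>M\<close>. The identity holds at every valuation, even where that
  coefficient vanishes.\<close>

lemma upoly_pseudo_division:
  assumes M: "M \<in> upoly V N" "N > 0" and F: "F \<in> upoly V K"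
  shows "\<exists>s Q R. Q \<in> upoly V (K - N) \<and> R \<in> upoly V (N - 1) \<and>
    (\<forall>w. smult (coeff (M w) N ^ s) (F w) = Q w * M w + R w)"
  using F
proof (induction K arbitrary: F rule: less_induct)
  case (less K)
  show ?case
  proof (cases "K < N")
    case True
    then have "F \<in> upoly V (N - 1)" using less.prems upoly_mono by fastforce
    moreover have "(\<lambda>_. 0) \<in> upoly V (K - N)" by (auto simp: upoly_def polyfun_Rats_simps)
    ultimately show ?thesis
      by (intro exI[of _ 0] exI[of _ "\<lambda>_. 0"] exI[of _ F]) auto
  next
    case False
    define T where "T = (\<lambda>w. monom (coeff (F w) K) (K - N))"
    define F' where "F' = (\<lambda>w. smult (coeff (M w) N) (F w) - T w * M w)"
    have T: "T \<in> upoly V (K - N)"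
      unfolding T_def by (rule upoly_monom[OF upoly_coeff[OF less.prems]])
    have "(\<lambda>w. T w * M w) \<in> upoly V K"
      using upoly_mult[OF T M(1)] False by simp
    then have "F' \<in> upoly V K"
      unfolding F'_def by (intro upoly_diff upoly_smult upoly_coeff[OF M(1)] less.prems)
    moreover have "coeff (F' w) K = 0" for w
      using False by (simp add: F'_def T_def coeff_monom_mult)
    ultimately have F': "F' \<in> upoly V (K - 1)" using upoly_lower False M(2) by auto
    then obtain s Q R where IH: "Q \<in> upoly V (K - 1 - N)" "R \<in> upoly V (N - 1)"
      "\<And>w. smult (coeff (M w) N ^ s) (F' w) = Q w * M w + R w"
      using less.IH[of "K - 1" F'] False M(2) by auto
    let ?Q = "\<lambda>w. Q w + smult (coeff (M w) N ^ s) (T w)"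
    have "?Q \<in> upoly V (K - N)"
      using IH(1) T M(1) by (intro upoly_add upoly_smult polyfun_Rats_simps upoly_coeff) (auto intro: upoly_mono)
    moreover have "smult (coeff (M w) N ^ Suc s) (F w) = ?Q w * M w + R w" for w
    proof -
      have "smult (coeff (M w) N ^ Suc s) (F w) =
          smult (coeff (M w) N ^ s) (F' w) + smult (coeff (M w) N ^ s) (T w * M w)"
        unfolding F'_def by (simp add: smult_diff_right mult.commute)
      also have "\<dots> = ?Q w * M w + R w"
        by (simp add: IH(3) distrib_right)
      finally show ?thesis .
    qed
    ultimately show ?thesis using IH(2) by blast
  qed
qed

text \<open>
  The new value is generic if nothing of positive degree vanishes on \<open>W\<close>, and otherwise a root
  of the specialisation at \<open>b\<close> of a polynomial \<open>M\<close> of least degree vanishing on \<open>W\<close>.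
\<close>

theorem extend_specialisation:
  fixes W :: "(('v \<Rightarrow> 'k::{alg_closed_field, field_char_0}) \<times> 'k) set"
  assumes prime: "\<And>F G N M. F \<in> upoly V N \<Longrightarrow> G \<in> upoly V M \<Longrightarrow>
      \<forall>(w, t)\<in>W. poly (F w) t * poly (G w) t = 0 \<Longrightarrow>
      (\<forall>(w, t)\<in>W. poly (F w) t = 0) \<or> (\<forall>(w, t)\<in>W. poly (G w) t = 0)"
    and b: "\<And>f. f \<in> polyfun \<rat> V \<Longrightarrow> f b = 0 \<longleftrightarrow> (\<forall>(w, t)\<in>W. f w = 0)"
    and trans: "\<exists>d. \<forall>F N. F \<in> upoly V N \<longrightarrow> poly (F b) d = 0 \<longrightarrow> F b = 0"
  shows "\<exists>d. \<forall>F N. F \<in> upoly V N \<longrightarrow> (poly (F b) d = 0 \<longleftrightarrow> (\<forall>(w, t)\<in>W. poly (F w) t = 0))"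
proof -
  define Z where "Z F \<longleftrightarrow> (\<forall>(w, t)\<in>W. poly (F w) t = 0)" for F :: "('v \<Rightarrow> 'k) \<Rightarrow> 'k poly"
  have ZD: "poly (F w) t = 0" if "Z F" "(w, t) \<in> W" for F w t
    using that unfolding Z_def by blast
  have ZI: "Z F" if "\<And>w t. (w, t) \<in> W \<Longrightarrow> poly (F w) t = 0" for F
    using that unfolding Z_def by blast
  have prime': "Z F \<or> Z G" if "F \<in> upoly V N" "G \<in> upoly V M"
    "\<And>w t. (w, t) \<in> W \<Longrightarrow> poly (F w) t * poly (G w) t = 0" for F G N M
    using prime[OF that(1,2)] that(3) unfolding Z_def by blast
  have Z_coeffs: "Z F" if "F \<in> upoly V N" "F b = 0" for F N
  proof -
    have "coeff (F w) i = 0" if "(w, t) \<in> W" for w t i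
      using b[OF upoly_coeff[OF \<open>F \<in> upoly V N\<close>, of i]] \<open>F b = 0\<close> that by auto
    then have "F w = 0" if "(w, t) \<in> W" for w t using that by (simp add: poly_eq_iff)
    then show ?thesis unfolding Z_def by (auto simp: split_beta)
  qed
  \<comment> \<open>By \<open>b\<close>, a top coefficient that vanishes at \<open>b\<close>
    vanishes on \<open>W\<close> as well, so removing it changes nothing at either place.
    Polynomials of least degree therefore have a leading coefficient that is nonzero at
    \<open>b\<close>.\<close>
  have truncate: "\<exists>F'. F' \<in> upoly V (N - 1) \<and> F' b = F b \<and> (\<forall>(w, t)\<in>W. F' w = F w)"
    if F: "F \<in> upoly V N" "coeff (F b) N = 0" "N > 0" for F N
  proof -
    define F' where "F' = (\<lambda>w. F w - monom (coeff (F w) N) N)"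
    have "F' \<in> upoly V N" unfolding F'_def by (intro upoly_diff upoly_monom upoly_coeff[OF F(1)] F(1))
    from upoly_lower[OF this]
    have "F' \<in> upoly V (N - 1)"
      by (auto simp: F'_def F(3))
    moreover have "\<forall>(w, t)\<in>W. coeff (F w) N = 0" using b[OF upoly_coeff[OF F(1)]] F(2) by blast
    ultimately show ?thesis using F(2) by (intro exI[of _ F']) (auto simp: F'_def)
  qed
  show ?thesis
  proof (cases "\<forall>F N. F \<in> upoly V N \<longrightarrow> Z F \<longrightarrow> F b = 0")
    case True
    obtain d where d: "\<forall>F N. F \<in> upoly V N \<longrightarrow> poly (F b) d = 0 \<longrightarrow> F b = 0" using trans ..
    show ?thesis unfolding Z_def[symmetric]
    proof (intro exI[of _ d] allI impI iffI)
      fix F :: "('v \<Rightarrow> 'k) \<Rightarrow> 'k poly" and N assume F: "F \<in> upoly V N"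
      show "Z F" if "poly (F b) d = 0" using d F that Z_coeffs by blast
      show "poly (F b) d = 0" if "Z F"
      proof -
        have "F b = 0" using True F that by blast
        then show ?thesis by simp
      qed
    qed
  next
    case False
    let ?P = "\<lambda>N. \<exists>F. F \<in> upoly V N \<and> Z F \<and> F b \<noteq> 0"
    define N where "N = (LEAST N. ?P N)"
    obtain F0 K0 where "F0 \<in> upoly V K0" "Z F0" "F0 b \<noteq> 0" using False by blast
    then have "?P K0" by (intro exI[of _ F0] conjI)
    then have "?P N" unfolding N_def by (rule LeastI[of ?P])
    then obtain M where M: "M \<in> upoly V N" "Z M" "M b \<noteq> 0" by blast
    have N_min: "N \<le> K" if "F \<in> upoly V K" "Z F" "F b \<noteq> 0" for F K
      unfolding N_def by (rule Least_le) (intro exI[of _ F] conjI that)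
    \<comment> \<open>A relation of degree 0 on \<open>W\<close> concerns the old variables only,
      and so would already hold at \<open>b\<close>.\<close>
    have N_pos: "N > 0"
    proof (rule ccontr)
      assume "\<not> N > 0"
      then have "degree (M w) = 0" for w using upoly_degree[OF M(1), of w] by simp
      then have c: "M w = [:coeff (M w) 0:]" for w by (metis degree_0_id)
      have "poly (M w) t = coeff (M w) 0" for w t by (subst c) simp
      then have "\<forall>(w, t)\<in>W. coeff (M w) 0 = 0" using M(2) unfolding Z_def by simp
      then show False using b[OF upoly_coeff[OF M(1)], of 0] c[of b] M(3) by auto
    qed
    have M_lead: "coeff (M b) N \<noteq> 0"
    proof
      assume "coeff (M b) N = 0"
      then obtain M' where "M' \<in> upoly V (N - 1)" "M' b = M b" "\<forall>(w, t)\<in>W. M' w = M w"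
        using truncate M(1) N_pos by blast
      then show False using N_min[of M' "N - 1"] M N_pos unfolding Z_def by (auto simp: split_beta)
    qed
    have "degree (M b) > 0" using M_lead N_pos le_degree by fastforce
    then obtain d where d: "poly (M b) d = 0" using alg_closed_imp_poly_has_root by blast
    \<comment> \<open>The root \<open>d\<close> of \<open>M b\<close> might satisfy a relation of
      lower degree that does not hold on \<open>W\<close>. \<open>G\<close> is a relation at
      \<open>d\<close> of least degree \<open>K\<close>; such a collapse would mean
      \<open>K < N\<close>.\<close>
    let ?P' = "\<lambda>N. \<exists>F. F \<in> upoly V N \<and> poly (F b) d = 0 \<and> F b \<noteq> 0"
    define K where "K = (LEAST N. ?P' N)"
    have "?P' N" using M(1,3) d by (intro exI[of _ M] conjI)
    then have "?P' K" unfolding K_def by (rule LeastI[of ?P'])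
    then obtain G where G: "G \<in> upoly V K" "poly (G b) d = 0" "G b \<noteq> 0" by blast
    have K_min: "K \<le> L" if "F \<in> upoly V L" "poly (F b) d = 0" "F b \<noteq> 0" for F L
      unfolding K_def by (rule Least_le) (intro exI[of _ F] conjI that)
    have K_pos: "K > 0"
    proof (rule ccontr)
      assume "\<not> K > 0"
      then have "degree (G b) = 0" using upoly_degree[OF G(1), of b] by simp
      then obtain c where "G b = [:c:]" by (metis degree_0_id)
      then show False using G by simp
    qed
    have G_lead: "coeff (G b) K \<noteq> 0"
    proof
      assume "coeff (G b) K = 0"
      then obtain G' where "G' \<in> upoly V (K - 1)" "G' b = G b"
        using truncate G(1) K_pos by blast
      then show False using K_min[of G' "K - 1"] G K_pos by auto
    qed
    \<comment> \<open>Divide \<open>M\<close> by \<open>G\<close>: the remainder vanishes at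
      \<open>b\<close> by minimality of \<open>K\<close>, hence on \<open>W\<close>, so
      \<open>Q * G\<close> vanishes on \<open>W\<close>. By primality one factor does, and both are
      nonzero at \<open>b\<close>. For \<open>Q\<close>, of degree at most \<open>N - K\<close>,
      this contradicts minimality of \<open>N\<close>; for \<open>G\<close> it gives
      \<open>N \<le> K\<close>.\<close>
    have K_ge: "N \<le> K"
    proof -
      obtain s Q R where QR: "Q \<in> upoly V (N - K)" "R \<in> upoly V (K - 1)"
        "\<And>w. smult (coeff (G w) K ^ s) (M w) = Q w * G w + R w"
        using upoly_pseudo_division[OF G(1) K_pos M(1)] by blast
      have "poly (R b) d = 0" using arg_cong[OF QR(3)[of b], of "\<lambda>p. poly p d"] d G(2) by simp
      then have Rb: "R b = 0" using K_min[OF QR(2)] K_pos by fastforce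
      then have "Z R" using Z_coeffs QR(2) by blast
      have "poly (Q w) t * poly (G w) t = 0" if "(w, t) \<in> W" for w t
        using arg_cong[OF QR(3)[of w], of "\<lambda>p. poly p t"] ZD[OF M(2) that] ZD[OF \<open>Z R\<close> that] by simp
      then have "Z Q \<or> Z G" by (rule prime'[OF QR(1) G(1)])
      moreover have "Q b \<noteq> 0" using QR(3)[of b] Rb G_lead M(3) by auto
      ultimately show ?thesis using N_min[OF QR(1)] N_min[OF G(1) _ G(3)] K_pos N_pos by fastforce
    qed
    have "poly (F b) d = 0 \<longleftrightarrow> Z F" if F: "F \<in> upoly V L" for F L
    proof -
      obtain s Q R where QR: "Q \<in> upoly V (L - N)" "R \<in> upoly V (N - 1)"
        "\<And>w. smult (coeff (M w) N ^ s) (F w) = Q w * M w + R w"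
        using upoly_pseudo_division[OF M(1) N_pos F] by blast
      have ev: "coeff (M w) N ^ s * poly (F w) t = poly (Q w) t * poly (M w) t + poly (R w) t" for w t
        using arg_cong[OF QR(3)[of w], of "\<lambda>p. poly p t"] by simp
      show ?thesis
      proof
        assume "Z F"
        have "Z R"
        proof (rule ZI)
          fix w t assume "(w, t) \<in> W"
          then show "poly (R w) t = 0" using ev[of w t] ZD[OF \<open>Z F\<close>] ZD[OF M(2)] by simp
        qed
        then have "R b = 0" using N_min[OF QR(2)] N_pos by fastforce
        then show "poly (F b) d = 0" using ev[of b d] d M_lead by simp
      next
        assume "poly (F b) d = 0"
        then have "poly (R b) d = 0" using ev[of b d] d by simp
        then have "R b = 0" using K_min[OF QR(2)] K_ge N_pos by fastforce
        then have "Z R" using Z_coeffs QR(2) by blast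
        \<comment> \<open>The power of the leading coefficient is viewed as a polynomial of degree
          0, so that primality can cancel it; it does not vanish on \<open>W\<close> because it does
          not vanish at \<open>b\<close>.\<close>
        let ?c = "\<lambda>w. monom (coeff (M w) N ^ s) 0"
        have c: "?c \<in> upoly V 0"
          by (intro upoly_monom polyfun_Rats_simps upoly_coeff[OF M(1)])
        have "poly (?c w) t * poly (F w) t = 0" if "(w, t) \<in> W" for w t
          using ev[of w t] ZD[OF \<open>Z R\<close> that] ZD[OF M(2) that] by (simp add: poly_monom)
        then have "Z ?c \<or> Z F" by (rule prime'[OF c F])
        moreover have "\<not> Z ?c"
        proof
          assume "Z ?c"
          then have "\<forall>(w, t)\<in>W. coeff (M w) N ^ s = 0" unfolding Z_def by (simp add: poly_monom)
          then show False
            using b[OF polyfun_Rats_simps(4)[OF upoly_coeff[OF M(1)]], of N s] M_lead by simp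
        qed
        ultimately show "Z F" by blast
      qed
    qed
    then show ?thesis unfolding Z_def by blast
  qed
qed

section \<open>Partial isomorphisms and generic points\<close>

lemma exists_generic_value:
  fixes b :: "'v \<Rightarrow> 'k::field_char_0"
  assumes "\<forall>A :: 'k set. finite A \<longrightarrow> (\<exists>d. \<not> alg_over (gen A) d)" "finite V"
  shows "\<exists>d. \<forall>F N. F \<in> upoly V N \<longrightarrow> poly (F b) d = 0 \<longrightarrow> F b = 0"
proof -
  obtain d where d: "\<not> alg_over (gen (b ` V)) d" using assms by blast
  have "F b = 0" if F: "F \<in> upoly V N" "poly (F b) d = 0" for F N
  proof (rule ccontr)
    assume "F b \<noteq> 0"
    moreover have "\<forall>i. coeff (F b) i \<in> gen (b ` V)"
      using polyfun_in_gen[OF upoly_coeff[OF F(1)]] by blast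
    ultimately show False using d F(2) unfolding alg_over_def by blast
  qed
  then show ?thesis by blast
qed

text \<open>
  The pairs in \<open>R\<close> are themselves the variables; the two valuations are the projections.
\<close>

definition partial_iso :: "('k::field_char_0 \<times> 'k) set \<Rightarrow> bool" where
  "partial_iso R \<longleftrightarrow> (\<forall>f\<in>polyfun \<rat> R. f fst = 0 \<longleftrightarrow> f snd = 0)"

lemma partial_iso_forth:
  fixes R :: "('k::{alg_closed_field, field_char_0} \<times> 'k) set"
  assumes tr: "\<forall>A :: 'k set. finite A \<longrightarrow> (\<exists>d. \<not> alg_over (gen A) d)"
    and R: "finite R" "partial_iso R"
  shows "\<exists>d. partial_iso (insert (c, d) R)"
proof -
  \<comment> \<open>With the single point \<open>(fst, c)\<close> as \<open>W\<close>, primality is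
    the absence of zero divisors, and the hypothesis on \<open>b\<close> is that \<open>R\<close> is
    a partial isomorphism.\<close>
  have "\<exists>d. \<forall>F N. F \<in> upoly R N \<longrightarrow>
      (poly (F snd) d = 0 \<longleftrightarrow> (\<forall>(w, t)\<in>{(fst, c)}. poly (F w) t = 0))"
    by (rule extend_specialisation[OF _ _ exists_generic_value[OF tr R(1)]])
      (use R(2) in \<open>auto simp: partial_iso_def\<close>)
  then obtain d where d: "\<And>F N. F \<in> upoly R N \<Longrightarrow> poly (F snd) d = 0 \<longleftrightarrow> poly (F fst) c = 0"
    by auto
  have "f fst = 0 \<longleftrightarrow> f snd = 0" if f: "f \<in> polyfun \<rat> (insert (c, d) R)" for f
  proof -
    obtain F N where "F \<in> upoly R N" "\<And>w. f w = poly (F w) (w (c, d))"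
      using polyfun_insert_upoly[OF f] by blast
    then show ?thesis using d by simp
  qed
  then show ?thesis unfolding partial_iso_def by blast
qed

lemma partial_iso_converse:
  assumes "partial_iso R"
  shows "partial_iso (R\<inverse>)"
  unfolding partial_iso_def
proof
  fix f :: "('a \<times> 'a \<Rightarrow> 'a) \<Rightarrow> 'a" assume f: "f \<in> polyfun \<rat> (R\<inverse>)"
  have "(\<lambda>u. f (\<lambda>v. u (prod.swap v))) \<in> polyfun \<rat> R"
    by (rule polyfun_subst[OF f]) (auto intro: polyfun.var)
  then have "f (\<lambda>v. fst (prod.swap v)) = 0 \<longleftrightarrow> f (\<lambda>v. snd (prod.swap v)) = 0"
    using assms unfolding partial_iso_def by fast
  moreover have "(\<lambda>v. fst (prod.swap v)) = (snd :: 'a \<times> 'a \<Rightarrow> 'a)"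
    "(\<lambda>v. snd (prod.swap v)) = (fst :: 'a \<times> 'a \<Rightarrow> 'a)" by auto
  ultimately show "f fst = 0 \<longleftrightarrow> f snd = 0" by simp
qed

lemma partial_iso_back:
  fixes R :: "('k::{alg_closed_field, field_char_0} \<times> 'k) set"
  assumes tr: "\<forall>A :: 'k set. finite A \<longrightarrow> (\<exists>d. \<not> alg_over (gen A) d)"
    and R: "finite R" "partial_iso R"
  shows "\<exists>c. partial_iso (insert (c, d) R)"
proof -
  obtain c where "partial_iso (insert (d, c) (R\<inverse>))"
    using partial_iso_forth[OF tr _ partial_iso_converse[OF R(2)]] R(1) by auto
  moreover have "(insert (d, c) (R\<inverse>))\<inverse> = insert (c, d) R" by auto
  ultimately have "partial_iso (insert (c, d) R)" using partial_iso_converse by metis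
  then show ?thesis ..
qed

text \<open>A polynomial function uses finitely many pairs, all of which are present at some finite
  stage.\<close>

lemma partial_iso_Union:
  fixes R :: "nat \<Rightarrow> ('k::field_char_0 \<times> 'k) set"
  assumes "\<And>n. partial_iso (R n)" "\<And>n. R n \<subseteq> R (Suc n)"
  shows "partial_iso (\<Union>n. R n)"
  unfolding partial_iso_def
proof
  fix f :: "('k \<times> 'k \<Rightarrow> 'k) \<Rightarrow> 'k" assume "f \<in> polyfun \<rat> (\<Union>n. R n)"
  from polyfun_finite_vars[OF this]
  obtain V where V: "finite V" "V \<subseteq> (\<Union>n. R n)" "f \<in> polyfun \<rat> V" by blast
  have mono: "R i \<subseteq> R j" if "i \<le> j" for i j using lift_Suc_mono_le[of R] assms(2) that by blast
  have "\<exists>N. V \<subseteq> R N" using V(1,2)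
  proof induction
    case (insert v V)
    then obtain N M where NM: "V \<subseteq> R N" "v \<in> R M" by auto
    then have "insert v V \<subseteq> R (max N M)"
      using mono[of N "max N M"] mono[of M "max N M"] by auto
    then show ?case ..
  qed auto
  then obtain N where "V \<subseteq> R N" ..
  then have "f \<in> polyfun \<rat> (R N)" by (rule polyfun_mono[OF V(3) order_refl])
  then show "f fst = 0 \<longleftrightarrow> f snd = 0" using assms(1) unfolding partial_iso_def by blast
qed

section \<open>From partial isomorphisms to field automorphisms\<close>

definition field_auto :: "('k::field \<Rightarrow> 'k) \<Rightarrow> bool" where
  "field_auto \<sigma> \<longleftrightarrow> bij \<sigma> \<and> (\<forall>x y. \<sigma> (x + y) = \<sigma> x + \<sigma> y) \<and> (\<forall>x y. \<sigma> (x * y) = \<sigma> x * \<sigma> y)"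

text \<open>Equality, sum and product are polynomial relations between two or three pairs:
  \<open>R\<close> preserves them in both directions, so it is the graph of an injective map that
  respects the field operations.\<close>

lemma partial_iso_graph:
  fixes R :: "('k::field_char_0 \<times> 'k) set"
  assumes R: "partial_iso R" and tot: "\<And>c. \<exists>d. (c, d) \<in> R" and sur: "\<And>d. \<exists>c. (c, d) \<in> R"
  shows "\<exists>\<sigma>. field_auto \<sigma> \<and> R = range (\<lambda>c. (c, \<sigma> c))"
proof -
  have neg: "-1 \<in> (\<rat> :: 'k set)" by simp
  have eq: "a = c \<longleftrightarrow> b = d" if "(a, b) \<in> R" "(c, d) \<in> R" for a b c d
  proof -
    have "(\<lambda>w. w (a, b) - w (c, d) :: 'k) \<in> polyfun \<rat> R"
      using that by (intro polyfun_diff neg polyfun.var)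
    with R have "(fst (a, b) - fst (c, d) = 0) = (snd (a, b) - snd (c, d) = 0)"
      unfolding partial_iso_def by fast
    then show ?thesis by simp
  qed
  obtain \<sigma> where \<sigma>: "\<And>c. (c, \<sigma> c) \<in> R" using tot by metis
  have "R = range (\<lambda>c. (c, \<sigma> c))"
  proof
    show "range (\<lambda>c. (c, \<sigma> c)) \<subseteq> R" using \<sigma> by blast
    show "R \<subseteq> range (\<lambda>c. (c, \<sigma> c))"
    proof clarify
      fix a b assume "(a, b) \<in> R"
      then have "b = \<sigma> a" using eq[OF _ \<sigma>[of a]] by blast
      then show "(a, b) \<in> range (\<lambda>c. (c, \<sigma> c))" by blast
    qed
  qed
  moreover have "bij \<sigma>"
  proof (rule bijI)
    show "inj \<sigma>" by (rule injI) (use eq[OF \<sigma> \<sigma>] in blast)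
    have "\<exists>c. d = \<sigma> c" for d
    proof -
      obtain c where "(c, d) \<in> R" using sur by blast
      then have "d = \<sigma> c" using eq[OF _ \<sigma>[of c]] by blast
      then show ?thesis ..
    qed
    then show "surj \<sigma>" unfolding surj_def by blast
  qed
  moreover have "\<sigma> (x + y) = \<sigma> x + \<sigma> y" for x y
  proof -
    have "(\<lambda>w. w (x, \<sigma> x) + w (y, \<sigma> y) - w (x + y, \<sigma> (x + y)) :: 'k) \<in> polyfun \<rat> R"
      by (intro polyfun_diff neg polyfun.add polyfun.var \<sigma>)
    with R have "(fst (x, \<sigma> x) + fst (y, \<sigma> y) - fst (x + y, \<sigma> (x + y)) = 0) =
        (snd (x, \<sigma> x) + snd (y, \<sigma> y) - snd (x + y, \<sigma> (x + y)) = 0)"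
      unfolding partial_iso_def by fast
    then show ?thesis by simp
  qed
  moreover have "\<sigma> (x * y) = \<sigma> x * \<sigma> y" for x y
  proof -
    have "(\<lambda>w. w (x, \<sigma> x) * w (y, \<sigma> y) - w (x * y, \<sigma> (x * y)) :: 'k) \<in> polyfun \<rat> R"
      by (intro polyfun_diff neg polyfun.mult polyfun.var \<sigma>)
    with R have "(fst (x, \<sigma> x) * fst (y, \<sigma> y) - fst (x * y, \<sigma> (x * y)) = 0) =
        (snd (x, \<sigma> x) * snd (y, \<sigma> y) - snd (x * y, \<sigma> (x * y)) = 0)"
      unfolding partial_iso_def by fast
    then show ?thesis by simp
  qed
  ultimately show ?thesis unfolding field_auto_def by blast
qed

text \<open>Stage \<open>n\<close> fulfils the task \<open>Q n\<close> and puts the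
  \<open>n\<close>-th element of the field into both domain and range. Monotonicity lets a task,
  once achieved, survive into the union.\<close>

theorem extend_partial_iso:
  fixes R0 :: "('k::{alg_closed_field, field_char_0} \<times> 'k) set"
  assumes tr: "\<forall>A :: 'k set. finite A \<longrightarrow> (\<exists>d. \<not> alg_over (gen A) d)"
    and ct: "countable (UNIV :: 'k set)"
    and R0: "finite R0" "partial_iso R0"
    and task: "\<And>n R. R0 \<subseteq> R \<Longrightarrow> finite R \<Longrightarrow> partial_iso R \<Longrightarrow>
      \<exists>R'. R \<subseteq> R' \<and> finite R' \<and> partial_iso R' \<and> Q n R'"
    and mono: "\<And>n R R'. Q n R \<Longrightarrow> R \<subseteq> R' \<Longrightarrow> Q (n :: nat) R'"
  shows "\<exists>\<sigma>. field_auto \<sigma> \<and> R0 \<subseteq> range (\<lambda>c. (c, \<sigma> c)) \<and> (\<forall>n. Q n (range (\<lambda>c. (c, \<sigma> c))))"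
proof -
  define e where "e = from_nat_into (UNIV :: 'k set)"
  have e: "range e = UNIV" using range_from_nat_into[OF _ ct] by (simp add: e_def)
  let ?P = "\<lambda>(n::nat) R. R0 \<subseteq> R \<and> finite R \<and> partial_iso R"
  let ?S = "\<lambda>n R R'. R \<subseteq> R' \<and> Q n R' \<and> (\<exists>d. (e n, d) \<in> R') \<and> (\<exists>c. (c, e n) \<in> R')"
  have "\<exists>R. \<forall>n. ?P n (R n) \<and> ?S n (R n) (R (Suc n))"
  proof (rule dependent_nat_choice)
    show "\<exists>R. R0 \<subseteq> R \<and> finite R \<and> partial_iso R" using R0 by blast
    fix R n assume R: "R0 \<subseteq> R \<and> finite R \<and> partial_iso R"
    then obtain R1 where R1: "R \<subseteq> R1" "finite R1" "partial_iso R1" "Q n R1" using task by blast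
    obtain d where d: "partial_iso (insert (e n, d) R1)" using partial_iso_forth[OF tr R1(2,3)] by blast
    obtain c where c: "partial_iso (insert (c, e n) (insert (e n, d) R1))"
      using partial_iso_back[OF tr _ d] R1(2) by blast
    let ?R' = "insert (c, e n) (insert (e n, d) R1)"
    have "Q n ?R'" by (rule mono[OF R1(4)]) blast
    then show "\<exists>R'. (R0 \<subseteq> R' \<and> finite R' \<and> partial_iso R') \<and> ?S n R R'"
      using R R1(1,2) c by (intro exI[of _ ?R']) auto
  qed
  then obtain R where R: "\<And>n. ?P n (R n)" "\<And>n. ?S n (R n) (R (Suc n))" by blast
  let ?U = "\<Union>n. R n"
  have "partial_iso ?U" using R by (intro partial_iso_Union) auto
  moreover have "\<exists>d. (c, d) \<in> ?U" "\<exists>d. (d, c) \<in> ?U" for c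
  proof -
    obtain n where n: "c = e n" using e by (metis UNIV_I imageE)
    show "\<exists>d. (c, d) \<in> ?U" "\<exists>d. (d, c) \<in> ?U" using R(2)[of n] unfolding n by blast+
  qed
  ultimately obtain \<sigma> where \<sigma>: "field_auto \<sigma>" "?U = range (\<lambda>c. (c, \<sigma> c))"
    using partial_iso_graph[of ?U] by auto
  have "Q n ?U" for n by (rule mono[of n "R (Suc n)"]) (use R(2) in auto)
  moreover have "R0 \<subseteq> ?U" using R(1)[of 0] by blast
  ultimately show ?thesis using \<sigma>(1) unfolding \<sigma>(2) by blast
qed

lemma field_auto_simps:
  assumes "field_auto \<sigma>"
  shows "\<sigma> (x + y) = \<sigma> x + \<sigma> y" "\<sigma> (x * y) = \<sigma> x * \<sigma> y" "\<sigma> x = \<sigma> y \<longleftrightarrow> x = y"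
    "\<sigma> (inv_into UNIV \<sigma> x) = x" "inv_into UNIV \<sigma> (\<sigma> x) = x" "\<sigma> 0 = 0" "\<sigma> 1 = 1" "\<sigma> (- x) = - \<sigma> x"
    "\<sigma> x = 0 \<longleftrightarrow> x = 0"
proof -
  have b: "bij \<sigma>" and a: "\<And>x y. \<sigma> (x + y) = \<sigma> x + \<sigma> y" and m: "\<And>x y. \<sigma> (x * y) = \<sigma> x * \<sigma> y"
    using assms by (auto simp: field_auto_def)
  show "\<sigma> (x + y) = \<sigma> x + \<sigma> y" "\<sigma> (x * y) = \<sigma> x * \<sigma> y" by (rule a, rule m)
  show inj: "\<sigma> x = \<sigma> y \<longleftrightarrow> x = y" for x y using bij_is_inj[OF b] by (auto simp: inj_eq)
  show "\<sigma> (inv_into UNIV \<sigma> x) = x" by (rule surj_f_inv_f[OF bij_is_surj[OF b]])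
  show "inv_into UNIV \<sigma> (\<sigma> x) = x" by (rule inv_f_f[OF bij_is_inj[OF b]])
  show z: "\<sigma> 0 = 0" using a[of 0 0] by (metis add_0 add_cancel_left_right)
  show "\<sigma> x = 0 \<longleftrightarrow> x = 0" using inj[of x 0] z by simp
  have "\<sigma> 1 \<noteq> 0" using inj[of 1 0] z by simp
  then show "\<sigma> 1 = 1" using m[of 1 1] by simp
  show "\<sigma> (- x) = - \<sigma> x" using a[of x "- x"] z by (simp add: eq_neg_iff_add_eq_0 add.commute)
qed

lemma field_auto_inv:
  assumes "field_auto \<sigma>"
  shows "field_auto (inv_into UNIV \<sigma>)"
proof -
  note s = field_auto_simps[OF assms]
  have "bij (inv_into UNIV \<sigma>)" using assms bij_imp_bij_inv by (auto simp: field_auto_def)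
  moreover have "inv_into UNIV \<sigma> (x + y) = inv_into UNIV \<sigma> x + inv_into UNIV \<sigma> y" "inv_into UNIV \<sigma> (x * y) = inv_into UNIV \<sigma> x * inv_into UNIV \<sigma> y" for x y
    by (metis s(1,4,5), metis s(2,4,5))
  ultimately show ?thesis by (simp add: field_auto_def)
qed

lemma field_auto_Rats:
  fixes \<sigma> :: "'k::field_char_0 \<Rightarrow> 'k"
  assumes "field_auto \<sigma>" "c \<in> \<rat>"
  shows "\<sigma> c = c"
proof -
  note s = field_auto_simps[OF assms(1)]
  have n: "\<sigma> (of_nat n) = of_nat n" for n by (induction n) (auto simp: s)
  have i: "\<sigma> (of_int z) = of_int z" for z by (cases z rule: int_cases2) (auto simp: n s)
  obtain q where "c = of_rat q" using assms(2) by (rule Rats_cases)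
  then obtain a b where ab: "c = of_int a / of_int b" "b \<noteq> 0"
    by (cases q) (auto simp: of_rat_rat)
  then have "c * of_int b = of_int a" by simp
  moreover then have "\<sigma> c * of_int b = of_int a" using s(2)[of c "of_int b"] i by simp
  ultimately have "\<sigma> c * of_int b = c * of_int b" by simp
  then show ?thesis using ab(2) by (simp only: mult_right_cancel of_int_eq_0_iff not_False_eq_True)
qed

text \<open>Rational coefficients are fixed by every automorphism, which therefore acts on the
  valuation alone.\<close>

lemma field_auto_polyfun:
  fixes \<sigma> :: "'k::field_char_0 \<Rightarrow> 'k"
  assumes "field_auto \<sigma>" "f \<in> polyfun \<rat> V"
  shows "\<sigma> (f w) = f (\<lambda>v. \<sigma> (w v))"
  using assms(2) by induction (auto simp: field_auto_simps[OF assms(1)] field_auto_Rats[OF assms(1)])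

lemma field_auto_sum:
  assumes "field_auto \<sigma>"
  shows "\<sigma> (sum f I) = (\<Sum>i\<in>I. \<sigma> (f i))"
  by (induction I rule: infinite_finite_induct) (auto simp: field_auto_simps[OF assms])

lemma map_matrix_mult:
  assumes "field_auto \<sigma>"
  shows "map_matrix \<sigma> (A ** B) = map_matrix \<sigma> A ** map_matrix \<sigma> B"
  by (simp add: vec_eq_iff matrix_matrix_mult_def field_auto_sum[OF assms] field_auto_simps[OF assms])

lemma map_matrix_invertible:
  fixes A :: "'k::field^'n^'n"
  assumes "field_auto \<sigma>" "invertible A"
  shows "invertible (map_matrix \<sigma> A)"
proof -
  have "map_matrix \<sigma> (mat 1 :: 'k^'n^'n) = mat 1"
    by (simp add: vec_eq_iff mat_def field_auto_simps[OF assms(1)])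
  moreover obtain C where "A ** C = mat 1" "C ** A = mat 1" using assms(2) by (auto simp: invertible_def)
  ultimately show ?thesis
    unfolding invertible_def by (metis map_matrix_mult[OF assms(1)])
qed

text \<open>Only finitely many constants occur. Once they are variables the coefficients are
  rational, and automorphisms can be applied through the valuation.\<close>

lemma polyfun_constants_as_variables:
  fixes f :: "('v \<Rightarrow> 'k::field_char_0) \<Rightarrow> 'k"
  assumes "f \<in> polyfun UNIV V"
  shows "\<exists>C g. finite C \<and> g \<in> polyfun \<rat> (Inl ` C \<union> Inr ` V) \<and> (\<forall>w. f w = g (case_sum id w))"
  using assms
proof induction
  case (const c)
  show ?case
    by (intro exI[of _ "{c}"] exI[of _ "\<lambda>w. w (Inl c)"]) (auto intro: polyfun.var)
next
  case (var v)
  then show ?case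
    by (intro exI[of _ "{}"] exI[of _ "\<lambda>w. w (Inr v)"]) (auto intro: polyfun.var)
next
  case (add f g)
  then obtain C1 f' C2 g' where "finite C1" "finite C2" "\<forall>w. f w = f' (case_sum id w)"
    "\<forall>w. g w = g' (case_sum id w)"
    and fg: "f' \<in> polyfun \<rat> (Inl ` C1 \<union> Inr ` V)" "g' \<in> polyfun \<rat> (Inl ` C2 \<union> Inr ` V)" by blast
  moreover have "(\<lambda>w. f' w + g' w) \<in> polyfun \<rat> (Inl ` (C1 \<union> C2) \<union> Inr ` V)"
    by (intro polyfun.add polyfun_mono[OF fg(1)] polyfun_mono[OF fg(2)]) auto
  ultimately show ?case by (intro exI[of _ "C1 \<union> C2"] exI[of _ "\<lambda>w. f' w + g' w"]) auto
next
  case (mult f g)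
  then obtain C1 f' C2 g' where "finite C1" "finite C2" "\<forall>w. f w = f' (case_sum id w)"
    "\<forall>w. g w = g' (case_sum id w)"
    and fg: "f' \<in> polyfun \<rat> (Inl ` C1 \<union> Inr ` V)" "g' \<in> polyfun \<rat> (Inl ` C2 \<union> Inr ` V)" by blast
  moreover have "(\<lambda>w. f' w * g' w) \<in> polyfun \<rat> (Inl ` (C1 \<union> C2) \<union> Inr ` V)"
    by (intro polyfun.mult polyfun_mono[OF fg(1)] polyfun_mono[OF fg(2)]) auto
  ultimately show ?case by (intro exI[of _ "C1 \<union> C2"] exI[of _ "\<lambda>w. f' w * g' w"]) auto
qed

text \<open>
  The variable \<open>Inl c\<close> stands for the constant \<open>c\<close>, and \<open>Inr (i, j)\<close> for a matrix entry.
\<close>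

definition defined_over ::
    "'k::field_char_0 set \<Rightarrow> ((('k + 'n \<times> 'n) \<Rightarrow> 'k) \<Rightarrow> 'k) set \<Rightarrow> ('k^'n^'n) set \<Rightarrow> bool" where
  "defined_over C E B \<longleftrightarrow> E \<subseteq> polyfun \<rat> (Inl ` C \<union> range Inr) \<and>
    B = {A. invertible A \<and> (\<forall>f\<in>E. f (case_sum id (entries A)) = 0)}"

text \<open>By Hilbert's theorem finitely many equations suffice, and each has finitely many
  constants. Finiteness of \<open>C\<close> lets the back and forth start from the identity on
  \<open>C\<close>.\<close>

theorem exists_field_of_definition:
  fixes B :: "('k::field_char_0^'n^'n) set"
  assumes "closedin zariski B"
  shows "\<exists>C E. finite C \<and> defined_over C E B"
proof -
  obtain P :: "(('n \<times> 'n \<Rightarrow>\<^sub>0 nat) \<Rightarrow>\<^sub>0 'k) set" where P: "finite P" "B = zero_locus P"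
    using assms zero_locus_finite unfolding closedin_zariski by metis
  have "\<forall>p. \<exists>C g. finite C \<and> g \<in> polyfun \<rat> (Inl ` C \<union> range Inr) \<and>
      (\<forall>w :: 'n \<times> 'n \<Rightarrow> 'k. mpoly_eval (\<lambda>a. a) w p = g (case_sum id w))"
    by (intro allI polyfun_constants_as_variables polyfun_mpoly_eval) auto
  then obtain C g where Cg: "\<And>p. finite (C p)" "\<And>p. g p \<in> polyfun \<rat> (Inl ` C p \<union> range Inr)"
    "\<And>p (w :: 'n \<times> 'n \<Rightarrow> 'k). mpoly_eval (\<lambda>a. a) w p = g p (case_sum id w)"
    unfolding choice_iff by blast
  have "g p \<in> polyfun \<rat> (Inl ` (\<Union>p\<in>P. C p) \<union> range Inr)" if "p \<in> P" for p
    using that by (intro polyfun_mono[OF Cg(2)]) auto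
  then have "defined_over (\<Union>p\<in>P. C p) (g ` P) B"
    unfolding defined_over_def P(2) zero_locus_entries using Cg(3) by auto
  then show ?thesis using P(1) Cg(1) by blast
qed

lemma defined_over_map_matrix:
  assumes "defined_over C E B" "field_auto \<sigma>" "\<And>c. c \<in> C \<Longrightarrow> \<sigma> c = c" "A \<in> B"
  shows "map_matrix \<sigma> A \<in> B"
proof -
  have "f (case_sum id (entries (map_matrix \<sigma> A))) = 0" if "f \<in> E" for f
  proof -
    have f: "f \<in> polyfun \<rat> (Inl ` C \<union> range Inr)" using assms(1) that by (auto simp: defined_over_def)
    have "f (case_sum id (entries (map_matrix \<sigma> A))) = f (\<lambda>v. \<sigma> (case_sum id (entries A) v))"
      by (rule polyfun_cong[OF f]) (auto simp: assms(3))
    also have "\<dots> = \<sigma> (f (case_sum id (entries A)))"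
      by (rule field_auto_polyfun[OF assms(2) f, symmetric])
    also have "f (case_sum id (entries A)) = 0" using assms(1,4) that by (auto simp: defined_over_def)
    finally show ?thesis by (simp add: field_auto_simps[OF assms(2)])
  qed
  then show ?thesis using assms(1,4) map_matrix_invertible[OF assms(2)] by (auto simp: defined_over_def)
qed

definition prime_locus :: "('k::comm_ring_1^'n^'n) set \<Rightarrow> bool" where
  "prime_locus B \<longleftrightarrow> B \<noteq> {} \<and> (\<forall>f\<in>polyfun UNIV UNIV. \<forall>g\<in>polyfun UNIV UNIV.
    (\<forall>h\<in>B. f (entries h) * g (entries h) = 0) \<longrightarrow>
    (\<forall>h\<in>B. f (entries h) = 0) \<or> (\<forall>h\<in>B. g (entries h) = 0))"

lemma prime_locusD:
  assumes "prime_locus B" "f \<in> polyfun UNIV UNIV" "g \<in> polyfun UNIV UNIV"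
    "\<And>h. h \<in> B \<Longrightarrow> f (entries h) * g (entries h) = 0"
  shows "(\<forall>h\<in>B. f (entries h) = 0) \<or> (\<forall>h\<in>B. g (entries h) = 0)"
  using assms(1)[unfolded prime_locus_def, THEN conjunct2, rule_format, OF assms(2,3)] assms(4) by simp

text \<open>The matrix entries are found one at a time: each new value must satisfy, over
  \<open>A\<close> and the earlier entries, precisely the relations that hold on all of
  \<open>B\<close>.\<close>

theorem generic_assignment:
  fixes B :: "('k::{alg_closed_field, field_char_0}^'n^'n) set"
  assumes tr: "\<forall>A :: 'k set. finite A \<longrightarrow> (\<exists>d. \<not> alg_over (gen A) d)"
    and prime: "prime_locus B"
    and A: "finite A"
    and P: "finite P"
  shows "\<exists>b. \<forall>f\<in>polyfun \<rat> (Inl ` A \<union> Inr ` P).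
    f (case_sum id b) = 0 \<longleftrightarrow> (\<forall>h\<in>B. f (case_sum id (entries h)) = 0)"
  using P
proof induction
  case empty
  \<comment> \<open>Without entry variables \<open>f\<close> sees only constants, so the default
    value 0 is harmless; a point of \<open>B\<close> is needed to make the quantifier over
    \<open>B\<close> nonvacuous.\<close>
  have eq: "f (case_sum id (\<lambda>_. 0)) = f (case_sum id (entries h))"
    if "f \<in> polyfun \<rat> (Inl ` A \<union> Inr ` {})" for f and h :: "'k^'n^'n"
    by (rule polyfun_cong[OF that]) auto
  obtain h where "h \<in> B" using prime by (auto simp: prime_locus_def)
  then show ?case using eq by (intro exI[of _ "\<lambda>_. 0"] ballI) metis
next
  case (insert p P)
  let ?V = "Inl ` A \<union> Inr ` P :: ('k + 'n \<times> 'n) set"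
  let ?w = "\<lambda>h. case_sum id (entries h) :: 'k + 'n \<times> 'n \<Rightarrow> 'k"
  obtain b where b: "\<And>f. f \<in> polyfun \<rat> ?V \<Longrightarrow>
      f (case_sum id b) = 0 \<longleftrightarrow> (\<forall>h\<in>B. f (?w h) = 0)"
    using insert.IH by blast
  \<comment> \<open>\<open>?w h\<close> contains all entries of \<open>h\<close>, but polynomials
    over \<open>?V\<close> see only those in \<open>P\<close>; the entry at \<open>p\<close> is the
    new coordinate.\<close>
  let ?W = "(\<lambda>h. (?w h, entries h p)) ` B"
  have poly_UNIV: "(\<lambda>u. poly (F (case_sum id u)) (u p)) \<in> polyfun UNIV UNIV"
    if "F \<in> upoly ?V N" for F :: "('k + 'n \<times> 'n \<Rightarrow> 'k) \<Rightarrow> 'k poly" and N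
  proof -
    have "(\<lambda>w. poly (F w) (w (Inr p))) \<in> polyfun UNIV UNIV"
      by (rule polyfun_mono[OF upoly_eval[OF that]]) auto
    then have "(\<lambda>u. (\<lambda>w. poly (F w) (w (Inr p))) (case_sum id u)) \<in> polyfun UNIV UNIV"
    proof (rule polyfun_subst)
      show "(\<lambda>u. case_sum id u v) \<in> polyfun UNIV UNIV" for v :: "'k + 'n \<times> 'n"
        by (cases v) (auto intro: polyfun.intros)
    qed
    then show ?thesis by simp
  qed
  have "\<exists>d. \<forall>F N. F \<in> upoly ?V N \<longrightarrow>
      (poly (F (case_sum id b)) d = 0 \<longleftrightarrow> (\<forall>(w, t)\<in>?W. poly (F w) t = 0))"
  proof (rule extend_specialisation)
    show "\<exists>d. \<forall>F N. F \<in> upoly ?V N \<longrightarrow> poly (F (case_sum id b)) d = 0 \<longrightarrow> F (case_sum id b) = 0"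
      using A insert.hyps(1) by (intro exists_generic_value[OF tr]) auto
    show "f (case_sum id b) = 0 \<longleftrightarrow> (\<forall>(w, t)\<in>?W. f w = 0)" if "f \<in> polyfun \<rat> ?V" for f
      using b[OF that] by auto
    fix F G N M assume FG: "F \<in> upoly ?V N" "G \<in> upoly ?V M"
      and 0: "\<forall>(w, t)\<in>?W. poly (F w) t * poly (G w) t = 0"
    have "(\<forall>h\<in>B. poly (F (?w h)) (entries h p) = 0) \<or> (\<forall>h\<in>B. poly (G (?w h)) (entries h p) = 0)"
      by (rule prime_locusD[OF prime poly_UNIV[OF FG(1)] poly_UNIV[OF FG(2)]]) (use 0 in auto)
    then show "(\<forall>(w, t)\<in>?W. poly (F w) t = 0) \<or> (\<forall>(w, t)\<in>?W. poly (G w) t = 0)" by auto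
  qed
  then obtain d where d: "\<And>F N. F \<in> upoly ?V N \<Longrightarrow>
      poly (F (case_sum id b)) d = 0 \<longleftrightarrow> (\<forall>h\<in>B. poly (F (?w h)) (entries h p) = 0)" by auto
  show ?case
  proof (intro exI[of _ "b(p := d)"] ballI)
    fix f :: "('k + 'n \<times> 'n \<Rightarrow> 'k) \<Rightarrow> 'k"
    assume "f \<in> polyfun \<rat> (Inl ` A \<union> Inr ` insert p P :: ('k + 'n \<times> 'n) set)"
    then have "f \<in> polyfun \<rat> (insert (Inr p) ?V)" by simp
    from polyfun_insert_upoly[OF this]
    obtain F N where F: "F \<in> upoly ?V N" "\<And>w. f w = poly (F w) (w (Inr p))" by blast
    have "F (case_sum id (b(p := d))) = F (case_sum id b)"
      by (rule upoly_cong[OF F(1)]) (use insert.hyps(2) in auto)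
    then show "f (case_sum id (b(p := d))) = 0 \<longleftrightarrow> (\<forall>h\<in>B. f (?w h) = 0)"
      using d[OF F(1)] by (simp add: F(2))
  qed
qed

text \<open>The generic entries satisfy the equations of \<open>B\<close>, whose constants lie in
  \<open>A\<close>. Invertibility is an open condition and needs its own argument.\<close>

theorem generic_point:
  fixes B :: "('k::{alg_closed_field, field_char_0}^'n^'n) set"
  assumes tr: "\<forall>A :: 'k set. finite A \<longrightarrow> (\<exists>d. \<not> alg_over (gen A) d)"
    and prime: "prime_locus B"
    and A: "finite A" "C \<subseteq> A" and B: "defined_over C E B"
  shows "\<exists>g\<in>B. \<forall>f\<in>polyfun \<rat> (Inl ` A \<union> range Inr).
    f (case_sum id (entries g)) = 0 \<longleftrightarrow> (\<forall>h\<in>B. f (case_sum id (entries h)) = 0)"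
proof -
  from generic_assignment[OF tr prime A(1) finite_class.finite_UNIV]
  obtain b where "\<forall>f\<in>polyfun \<rat> (Inl ` A \<union> range Inr).
      f (case_sum id b) = 0 \<longleftrightarrow> (\<forall>h\<in>B. f (case_sum id (entries h)) = 0)" ..
  note b = bspec[OF this]
  define g :: "'k^'n^'n" where "g = (\<chi> i j. b (i, j))"
  have eg: "entries g = b" by (auto simp: fun_eq_iff g_def)
  have "f (case_sum id (entries g)) = 0" if "f \<in> E" for f
  proof -
    have "f \<in> polyfun \<rat> (Inl ` C \<union> range Inr)" using B that by (auto simp: defined_over_def)
    then have "f \<in> polyfun \<rat> (Inl ` A \<union> range Inr)" by (rule polyfun_mono) (use A(2) in auto)
    moreover have "\<forall>h\<in>B. f (case_sum id (entries h)) = 0" using B that by (auto simp: defined_over_def)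
    ultimately show ?thesis using b eg by simp
  qed
  moreover have "invertible g"
  proof -
    \<comment> \<open>The determinant has rational coefficients and does not vanish on all of
      \<open>B\<close>, so by genericity it does not vanish at \<open>g\<close>.\<close>
    let ?det = "\<lambda>u :: 'k + 'n \<times> 'n \<Rightarrow> 'k.
      \<Sum>p | p permutes (UNIV :: 'n set). of_int (sign p) * (\<Prod>i\<in>UNIV. u (Inr (i, p i)))"
    have "?det \<in> polyfun \<rat> (Inl ` A \<union> range Inr)"
      by (intro polyfun_sum polyfun.mult polyfun_prod polyfun.const polyfun.var) auto
    from b[OF this, folded eg]
    have "?det (case_sum id (entries g)) = 0 \<longleftrightarrow> (\<forall>h\<in>B. ?det (case_sum id (entries h)) = 0)" .
    moreover have "?det (case_sum id (entries h)) = det h" for h by (simp add: det_def)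
    ultimately have "det g = 0 \<longleftrightarrow> (\<forall>h\<in>B. det h = 0)" by (simp only:)
    moreover obtain h where "h \<in> B" "invertible h"
      using B prime by (auto simp: defined_over_def prime_locus_def)
    ultimately show ?thesis by (auto simp: invertible_det_nz)
  qed
  ultimately have "g \<in> B" using B by (auto simp: defined_over_def)
  then show ?thesis using b eg by (intro bexI[of _ g]) auto
qed

section \<open>Lang's theorem and twisted conjugacy\<close>

text \<open>Evaluate at the preimage of \<open>h\<close> under \<tau>, which is again in
  \<open>B\<close>, and apply \<tau>: the constants \<alpha> turn into \<beta> and the matrix turns
  back into \<open>h\<close>.\<close>

lemma transfer_vanishing:
  fixes B :: "('k::field_char_0^'n^'n) set"
  assumes B: "defined_over C E B" and \<tau>: "field_auto \<tau>" "\<And>c. c \<in> C \<Longrightarrow> \<tau> c = c"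
    and \<alpha>\<beta>: "\<And>v. v \<in> V \<Longrightarrow> \<tau> (\<alpha> v) = \<beta> v"
    and f: "f \<in> polyfun \<rat> (Inl ` V \<union> range Inr)" "\<forall>h\<in>B. f (case_sum \<alpha> (entries h)) = 0"
  shows "\<forall>h\<in>B. f (case_sum \<beta> (entries h)) = 0"
proof
  fix h assume h: "h \<in> B"
  let ?h = "map_matrix (inv_into UNIV \<tau>) h"
  note s = field_auto_simps[OF \<tau>(1)]
  have "inv_into UNIV \<tau> c = c" if "c \<in> C" for c using \<tau>(2)[OF that] s(5)[of c] by simp
  then have "?h \<in> B" using defined_over_map_matrix[OF B field_auto_inv[OF \<tau>(1)]] h by blast
  then have "\<tau> (f (case_sum \<alpha> (entries ?h))) = 0" using f(2) s(6) by simp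
  also have "\<tau> (f (case_sum \<alpha> (entries ?h))) = f (\<lambda>v. \<tau> (case_sum \<alpha> (entries ?h) v))"
    by (rule field_auto_polyfun[OF \<tau>(1) f(1)])
  also have "\<dots> = f (case_sum \<beta> (entries h))"
    by (rule polyfun_cong[OF f(1)]) (auto simp: \<alpha>\<beta> s(4))
  finally show "f (case_sum \<beta> (entries h)) = 0" .
qed

text \<open>
  Both \<open>g\<close> and \<open>y g\<close> are generic points of \<open>B\<close>, so sending the entries of one to those of
  the other is compatible with any partial isomorphism that fixes a field of definition.
\<close>

theorem lang_step:
  fixes B :: "('k::{alg_closed_field, field_char_0}^'n^'n) set"
  assumes tr: "\<forall>A :: 'k set. finite A \<longrightarrow> (\<exists>d. \<not> alg_over (gen A) d)"
    and ct: "countable (UNIV :: 'k set)"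
    and prime: "prime_locus B"
    and C: "finite C" "defined_over C E B"
    and R: "finite R" "partial_iso R" "\<And>c. c \<in> C \<Longrightarrow> (c, c) \<in> R"
    and y: "y \<in> B" "(**) y ` B = B"
  shows "\<exists>g\<in>B. partial_iso (R \<union> range (\<lambda>p. (entries g p, entries (y ** g) p)))"
proof -
  \<comment> \<open>\<open>g\<close> has to be generic over both sides of \<open>R\<close> and over
    the entries of \<open>y\<close>, as relations at \<open>g\<close> and at \<open>y g\<close>
    together use all of these constants.\<close>
  define A where "A = C \<union> fst ` R \<union> snd ` R \<union> range (entries y)"
  have A: "finite A" "C \<subseteq> A" using C(1) R(1) by (auto simp: A_def)
  from generic_point[OF tr prime A C(2)]
  obtain g where g: "g \<in> B" and "\<forall>f\<in>polyfun \<rat> (Inl ` A \<union> range Inr).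
      f (case_sum id (entries g)) = 0 \<longleftrightarrow> (\<forall>h\<in>B. f (case_sum id (entries h)) = 0)" ..
  note generic = bspec[OF this(2)]
  \<comment> \<open>Back and forth with a void task: any automorphism that extends \<open>R\<close>
    will do. Its only use is to transport vanishing on \<open>B\<close> between the two sides of
    \<open>R\<close>.\<close>
  have "\<exists>\<tau>. field_auto \<tau> \<and> R \<subseteq> range (\<lambda>c. (c, \<tau> c)) \<and> (\<forall>n::nat. True)"
    by (rule extend_partial_iso[OF tr ct R(1,2)]) auto
  then obtain \<tau> where \<tau>: "field_auto \<tau>" "R \<subseteq> range (\<lambda>c. (c, \<tau> c))" by blast
  have \<tau>R: "\<tau> (fst v) = snd v" if "v \<in> R" for v using \<tau>(2) that by auto
  have \<tau>C: "\<tau> c = c" if "c \<in> C" for c using \<tau>R[OF R(3)[OF that]] by simp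
  note s = field_auto_simps[OF \<tau>(1)]
  have inv_R: "inv_into UNIV \<tau> (snd v) = fst v" if "v \<in> R" for v
    using \<tau>R[OF that] s(5)[of "fst v"] by simp
  have inv_C: "inv_into UNIV \<tau> c = c" if "c \<in> C" for c using \<tau>C[OF that] s(5)[of c] by simp
  have main: "f (case_sum fst (entries g)) = 0 \<longleftrightarrow> f (case_sum snd (entries (y ** g))) = 0"
    if f: "f \<in> polyfun \<rat> (Inl ` R \<union> range Inr)" for f :: "(('k \<times> 'k) + 'n \<times> 'n \<Rightarrow> 'k) \<Rightarrow> 'k"
  proof -
    \<comment> \<open>These substitutions turn a relation between pairs and matrix entries into one
      over \<open>A\<close>: \<open>s1\<close> reads first components, while \<open>s2\<close> reads
      second components and replaces the matrix by its product with \<open>y\<close>.\<close>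
    define s1 where "s1 u v = (case v of Inl r \<Rightarrow> u (Inl (fst r)) | Inr p \<Rightarrow> u (Inr p))"
      for u :: "'k + 'n \<times> 'n \<Rightarrow> 'k" and v :: "('k \<times> 'k) + 'n \<times> 'n"
    define s2 where "s2 u v = (case v of Inl r \<Rightarrow> u (Inl (snd r))
        | Inr p \<Rightarrow> (\<Sum>l\<in>UNIV. u (Inl (y $ fst p $ l)) * u (Inr (l, snd p))))"
      for u :: "'k + 'n \<times> 'n \<Rightarrow> 'k" and v :: "('k \<times> 'k) + 'n \<times> 'n"
    have RA: "fst v \<in> A" "snd v \<in> A" if "v \<in> R" for v using that by (auto simp: A_def)
    have yA: "y $ i $ l \<in> A" for i l
    proof -
      have "entries y (i, l) \<in> A" unfolding A_def by blast
      then show ?thesis by simp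
    qed
    have f1: "(\<lambda>u. f (s1 u)) \<in> polyfun \<rat> (Inl ` A \<union> range Inr)"
    proof (rule polyfun_subst[OF f])
      fix v :: "('k \<times> 'k) + 'n \<times> 'n" assume v: "v \<in> Inl ` R \<union> range Inr"
      show "(\<lambda>u. s1 u v) \<in> polyfun \<rat> (Inl ` A \<union> range Inr)"
        by (cases v) (use v RA in \<open>auto simp: s1_def intro!: polyfun.var\<close>)
    qed
    have f2: "(\<lambda>u. f (s2 u)) \<in> polyfun \<rat> (Inl ` A \<union> range Inr)"
    proof (rule polyfun_subst[OF f])
      fix v :: "('k \<times> 'k) + 'n \<times> 'n" assume v: "v \<in> Inl ` R \<union> range Inr"
      show "(\<lambda>u. s2 u v) \<in> polyfun \<rat> (Inl ` A \<union> range Inr)"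
      proof (cases v)
        case (Inl r)
        then show ?thesis using v RA by (auto simp: s2_def intro!: polyfun.var)
      next
        case (Inr p)
        then show ?thesis using yA by (auto simp: s2_def intro!: polyfun_sum polyfun.mult polyfun.var)
      qed
    qed
    have e1: "s1 (case_sum id (entries h)) = case_sum fst (entries h)" for h
      by (auto simp: s1_def fun_eq_iff split: sum.split)
    have e2: "s2 (case_sum id (entries h)) = case_sum snd (entries (y ** h))" for h
      by (auto simp: s2_def fun_eq_iff matrix_matrix_mult_def split: sum.split)
    \<comment> \<open>The chain uses genericity of \<open>g\<close>, transport by \<tau> and its
      inverse, invariance of \<open>B\<close> under translation by \<open>y\<close>, and genericity
      again.\<close>
    have "f (case_sum fst (entries g)) = 0 \<longleftrightarrow> (\<forall>h\<in>B. f (case_sum fst (entries h)) = 0)"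
      using generic[OF f1] by (simp add: e1)
    also have "\<dots> \<longleftrightarrow> (\<forall>h\<in>B. f (case_sum snd (entries h)) = 0)"
    proof
      show "\<forall>h\<in>B. f (case_sum snd (entries h)) = 0" if "\<forall>h\<in>B. f (case_sum fst (entries h)) = 0"
        by (rule transfer_vanishing[OF C(2) \<tau>(1) _ _ f that]) (fact \<tau>C \<tau>R)+
      show "\<forall>h\<in>B. f (case_sum fst (entries h)) = 0" if "\<forall>h\<in>B. f (case_sum snd (entries h)) = 0"
        by (rule transfer_vanishing[OF C(2) field_auto_inv[OF \<tau>(1)] _ _ f that]) (fact inv_C inv_R)+
    qed
    also have "\<dots> \<longleftrightarrow> (\<forall>h\<in>(**) y ` B. f (case_sum snd (entries h)) = 0)" by (simp only: y(2))
    also have "\<dots> \<longleftrightarrow> (\<forall>h\<in>B. f (case_sum snd (entries (y ** h))) = 0)" by simp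
    also have "\<dots> \<longleftrightarrow> f (case_sum snd (entries (y ** g))) = 0"
      using generic[OF f2] by (simp add: e2)
    finally show ?thesis .
  qed
  let ?e = "\<lambda>p. (entries g p, entries (y ** g) p)"
  \<comment> \<open>In \<open>main\<close> old pairs and matrix positions are distinct variables,
    whereas in \<open>partial_iso\<close> the pairs themselves are the variables and may coincide.
    So \<rho> names each pair once, preferring \<open>R\<close> and otherwise picking some
    position.\<close>
  define \<rho> :: "'k \<times> 'k \<Rightarrow> ('k \<times> 'k) + 'n \<times> 'n"
    where "\<rho> v = (if v \<in> R then Inl v else Inr (SOME p. v = ?e p))" for v
  have \<rho>: "?e (SOME p. v = ?e p) = v" if "v \<in> R \<union> range ?e" "v \<notin> R" for v
  proof -
    have "\<exists>p. v = ?e p" using that by blast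
    from someI_ex[OF this] show ?thesis by simp
  qed
  have "partial_iso (R \<union> range ?e)"
    unfolding partial_iso_def
  proof
    fix f :: "('k \<times> 'k \<Rightarrow> 'k) \<Rightarrow> 'k" assume f: "f \<in> polyfun \<rat> (R \<union> range ?e)"
    have "(\<lambda>u. f (\<lambda>v. u (\<rho> v))) \<in> polyfun \<rat> (Inl ` R \<union> range Inr)"
      by (rule polyfun_subst[OF f]) (auto simp: \<rho>_def intro!: polyfun.var)
    from main[OF this]
    have "f (\<lambda>v. case_sum fst (entries g) (\<rho> v)) = 0 \<longleftrightarrow>
        f (\<lambda>v. case_sum snd (entries (y ** g)) (\<rho> v)) = 0" .
    moreover have "f (\<lambda>v. case_sum fst (entries g) (\<rho> v)) = f fst"
    proof (rule polyfun_cong[OF f])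
      fix v assume "v \<in> R \<union> range ?e"
      then show "case_sum fst (entries g) (\<rho> v) = fst v"
        using arg_cong[OF \<rho>[of v], of fst] by (cases "v \<in> R") (auto simp: \<rho>_def)
    qed
    moreover have "f (\<lambda>v. case_sum snd (entries (y ** g)) (\<rho> v)) = f snd"
    proof (rule polyfun_cong[OF f])
      fix v assume "v \<in> R \<union> range ?e"
      then show "case_sum snd (entries (y ** g)) (\<rho> v) = snd v"
        using arg_cong[OF \<rho>[of v], of snd] by (cases "v \<in> R") (auto simp: \<rho>_def)
    qed
    ultimately show "f fst = 0 \<longleftrightarrow> f snd = 0" by simp
  qed
  with g show ?thesis by blast
qed

lemma countable_matrices:
  assumes "countable (UNIV :: 'k set)"
  shows "countable (B :: ('k^'n^'m) set)"
proof -
  have "countable (PiE (UNIV :: ('m \<times> 'n) set) (\<lambda>_. UNIV :: 'k set))"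
    by (rule countable_PiE) (auto simp: assms)
  then have "countable (UNIV :: ('m \<times> 'n \<Rightarrow> 'k) set)" by (simp add: PiE_UNIV_domain)
  then have "countable (entries ` B)" by (rule countable_subset[OF subset_UNIV])
  moreover have "inj_on entries B"
  proof (rule inj_onI)
    fix A A' :: "'k^'n^'m" assume "entries A = entries A'"
    then have "entries A (i, j) = entries A' (i, j)" for i j by simp
    then show "A = A'" by (simp add: vec_eq_iff)
  qed
  ultimately show ?thesis by (rule countable_image_inj_on)
qed

theorem lang_automorphism:
  fixes B :: "('k::{alg_closed_field, field_char_0}^'n^'n) set"
  assumes S: "transcendence_basis (S :: 'k set)" "countable S" "infinite S"
    and B: "subgroup B GL" "closedin zariski B" "connectedin zariski B"
  shows "\<exists>\<sigma>. field_auto \<sigma> \<and> map_matrix \<sigma> ` B = B \<and> (\<forall>y\<in>B. \<exists>g\<in>B. map_matrix \<sigma> g = y ** g)"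
proof -
  interpret GL: group "GL :: ('k^'n^'n) monoid" by (rule group_GL)
  have tr: "\<forall>A :: 'k set. finite A \<longrightarrow> (\<exists>d. \<not> alg_over (gen A) d)"
    by (intro allI impI exists_transcendental[OF S(1,3)])
  note ct = countable_field[OF S(1,2)]
  obtain C E where CE: "finite C" "defined_over C E B"
    using exists_field_of_definition[OF B(2)] by blast
  have Bne: "B \<noteq> {}" using subgroup.one_closed[OF B(1)] by blast
  have prime: "prime_locus B"
    unfolding prime_locus_def using Bne connected_group_prime[OF B] by simp
  define e where "e = from_nat_into B"
  have e: "range e = B" using range_from_nat_into[OF Bne countable_matrices[OF ct]] by (simp add: e_def)
  have translate: "(**) y ` B = B" if y: "y \<in> B" for y
  proof
    show "(**) y ` B \<subseteq> B" using y subgroup.m_closed[OF B(1)] by auto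
    show "B \<subseteq> (**) y ` B"
    proof
      fix b assume b: "b \<in> B"
      have "inv\<^bsub>GL\<^esub> y \<otimes>\<^bsub>GL\<^esub> b \<in> B"
        by (rule subgroup.m_closed[OF B(1) subgroup.m_inv_closed[OF B(1) y] b])
      moreover have "b = y \<otimes>\<^bsub>GL\<^esub> (inv\<^bsub>GL\<^esub> y \<otimes>\<^bsub>GL\<^esub> b)"
        using b by (intro GL.inv_solve_left[THEN iffD1, OF _ _ _ refl] GL.m_closed GL.inv_closed
          subgroup.mem_carrier[OF B(1)] y)
      ultimately show "b \<in> (**) y ` B" by auto
    qed
  qed
  \<comment> \<open>Starting from the identity on \<open>C\<close> forces \<sigma> to fix the
    constants in the equations of \<open>B\<close>, and thus to map \<open>B\<close> onto
    itself.\<close>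
  define R0 where "R0 = (\<lambda>c. (c, c)) ` C"
  have "partial_iso R0"
    unfolding partial_iso_def
  proof
    fix f :: "('k \<times> 'k \<Rightarrow> 'k) \<Rightarrow> 'k" assume "f \<in> polyfun \<rat> R0"
    then have "f fst = f snd" by (rule polyfun_cong) (auto simp: R0_def)
    then show "f fst = 0 \<longleftrightarrow> f snd = 0" by simp
  qed
  moreover have "finite R0" using CE(1) by (simp add: R0_def)
  \<comment> \<open>The Lang equation for the \<open>n\<close>-th point of \<open>B\<close> as a
    condition on the graph of \<sigma>: it asks for finitely many pairs, so a finite stage can meet
    it and enlargement keeps it.\<close>
  moreover define Q where "Q n R \<longleftrightarrow> (\<exists>g\<in>B. \<forall>p. (entries g p, entries (e n ** g) p) \<in> R)" for n R
  have "\<exists>R'. R \<subseteq> R' \<and> finite R' \<and> partial_iso R' \<and> Q n R'"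
    if R: "R0 \<subseteq> R" "finite R" "partial_iso R" for n R
  proof -
    have en: "e n \<in> B" using e by blast
    have "(c, c) \<in> R" if "c \<in> C" for c using R(1) that by (auto simp: R0_def)
    then obtain g where g: "g \<in> B" "partial_iso (R \<union> range (\<lambda>p. (entries g p, entries (e n ** g) p)))"
      using lang_step[OF tr ct prime CE R(2,3) _ en translate[OF en]] by blast
    let ?R' = "R \<union> range (\<lambda>p. (entries g p, entries (e n ** g) p))"
    have "Q n ?R'" unfolding Q_def using g(1) by blast
    then show ?thesis using g(2) R(2) by (intro exI[of _ ?R']) auto
  qed
  moreover have "Q n R'" if "Q n R" "R \<subseteq> R'" for n R R' using that unfolding Q_def by blast
  ultimately obtain \<sigma> where \<sigma>: "field_auto \<sigma>" "R0 \<subseteq> range (\<lambda>c. (c, \<sigma> c))"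
      "\<And>n. Q n (range (\<lambda>c. (c, \<sigma> c)))"
    using extend_partial_iso[OF tr ct, of R0 Q] by blast
  note s = field_auto_simps[OF \<sigma>(1)]
  have C: "\<sigma> c = c" if "c \<in> C" for c using \<sigma>(2) that by (auto simp: R0_def)
  have inv_C: "inv_into UNIV \<sigma> c = c" if "c \<in> C" for c using C[OF that] s(5)[of c] by simp
  have "map_matrix \<sigma> ` B = B"
  proof
    show "map_matrix \<sigma> ` B \<subseteq> B" using defined_over_map_matrix[OF CE(2) \<sigma>(1) C] by blast
    show "B \<subseteq> map_matrix \<sigma> ` B"
    proof
      fix h assume "h \<in> B"
      then have "map_matrix (inv_into UNIV \<sigma>) h \<in> B"
        using defined_over_map_matrix[OF CE(2) field_auto_inv[OF \<sigma>(1)] inv_C] by blast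
      moreover have "h = map_matrix \<sigma> (map_matrix (inv_into UNIV \<sigma>) h)" by (simp add: vec_eq_iff s(4))
      ultimately show "h \<in> map_matrix \<sigma> ` B" by blast
    qed
  qed
  moreover have "\<exists>g\<in>B. map_matrix \<sigma> g = y ** g" if y: "y \<in> B" for y
  proof -
    obtain n where n: "y = e n" using e y by blast
    obtain g where g: "g \<in> B" "\<And>p. (entries g p, entries (e n ** g) p) \<in> range (\<lambda>c. (c, \<sigma> c))"
      using \<sigma>(3)[of n] unfolding Q_def by blast
    have "\<sigma> (entries g p) = entries (e n ** g) p" for p using g(2)[of p] by auto
    from this[of "(_, _)"] have "map_matrix \<sigma> g = e n ** g" by (simp add: vec_eq_iff)
    then show ?thesis using g(1) n by blast
  qed
  ultimately show ?thesis using \<sigma>(1) by blast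
qed

lemma (in group) twisted_conj_action:
  assumes "\<phi> \<in> auto G"
  shows "group_action G (carrier G) (twisted_conj G \<phi>)"
proof -
  have hom: "\<phi> \<in> hom G G" using assms by (simp add: auto_def)
  note cl = hom_in_carrier[OF hom] and mul = hom_mult[OF hom]
  have one: "\<phi> \<one> = \<one>" by (rule hom_one[OF hom is_group is_group])
  let ?t = "twisted_conj G \<phi>"
  have t: "?t g x = g \<otimes> x \<otimes> \<phi> (inv g)" if "x \<in> carrier G" for g x
    using that by (simp add: twisted_conj_def)
  have t_cl: "?t g x \<in> carrier G" if "g \<in> carrier G" "x \<in> carrier G" for g x
    using that by (simp add: t cl)
  have t_mult: "?t (g \<otimes> h) x = ?t g (?t h x)"
    if "g \<in> carrier G" "h \<in> carrier G" "x \<in> carrier G" for g h x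
    using that by (simp add: t t_cl[unfolded t] cl mul inv_mult_group m_assoc)
  have t_one: "?t \<one> x = x" if "x \<in> carrier G" for x
    using that by (simp add: t one)
  have Bij: "?t g \<in> Bij (carrier G)" if g: "g \<in> carrier G" for g
  proof -
    have "bij_betw (?t g) (carrier G) (carrier G)"
      by (rule bij_betwI[where g = "?t (inv g)"])
        (use g in \<open>auto simp: t_cl t_mult[symmetric] t_one\<close>)
    moreover have "?t g \<in> extensional (carrier G)" by (simp add: twisted_conj_def)
    ultimately show ?thesis by (simp add: Bij_def)
  qed
  have "?t \<in> hom G (BijGroup (carrier G))"
  proof (rule homI)
    show "?t g \<in> carrier (BijGroup (carrier G))" if "g \<in> carrier G" for g
      using Bij[OF that] by (simp add: BijGroup_def)
    fix g h assume gh: "g \<in> carrier G" "h \<in> carrier G"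
    have "?t (g \<otimes> h) = compose (carrier G) (?t g) (?t h)"
    proof (rule extensionalityI[where A = "carrier G"])
      show "?t (g \<otimes> h) \<in> extensional (carrier G)" by (simp add: twisted_conj_def)
      show "?t (g \<otimes> h) x = compose (carrier G) (?t g) (?t h) x" if "x \<in> carrier G" for x
        using that gh by (simp add: t_mult compose_def)
    qed simp
    then show "?t (g \<otimes> h) = ?t g \<otimes>\<^bsub>BijGroup (carrier G)\<^esub> ?t h"
      using Bij gh by (simp add: BijGroup_def)
  qed
  then show ?thesis
    unfolding group_action_def group_hom_def group_hom_axioms_def
    using group_BijGroup is_group by blast
qed

text \<open>Solving \<open>g \<otimes> \<phi> (inv g) = z\<close> is the equation
  \<open>lang\<close> for \<open>y = inv z\<close>, so every element lies in the orbit of the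
  identity.\<close>

lemma (in group) twisted_conj_transitive:
  assumes \<phi>: "\<phi> \<in> auto G"
    and lang: "\<And>y. y \<in> carrier G \<Longrightarrow> \<exists>g\<in>carrier G. \<phi> g = y \<otimes> g"
  shows "transitive_action G (carrier G) (twisted_conj G \<phi>)"
proof -
  interpret act: group_action G "carrier G" "twisted_conj G \<phi>" by (rule twisted_conj_action[OF \<phi>])
  have hom: "\<phi> \<in> hom G G" using \<phi> by (simp add: auto_def)
  note cl = hom_in_carrier[OF hom] and mul = hom_mult[OF hom]
  have inv: "\<phi> (inv g) = inv (\<phi> g)" if "g \<in> carrier G" for g
    by (rule group_hom.hom_inv[OF group_hom.intro[OF is_group is_group group_hom_axioms.intro[OF hom]] that])
  show ?thesis
  proof (unfold_locales)
    fix x y assume xy: "x \<in> carrier G" "y \<in> carrier G"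
    have solve: "\<exists>g\<in>carrier G. g \<otimes> \<phi> (inv g) = z" if z: "z \<in> carrier G" for z
    proof -
      obtain g where g: "g \<in> carrier G" "\<phi> g = inv z \<otimes> g" using lang[of "inv z"] z by auto
      then have "g \<otimes> \<phi> (inv g) = g \<otimes> (inv g \<otimes> z)" using z by (simp add: inv inv_mult_group)
      also have "\<dots> = z" using g z by (simp add: m_assoc[symmetric])
      finally show ?thesis using g(1) by blast
    qed
    obtain u where u: "u \<in> carrier G" "u \<otimes> \<phi> (inv u) = x" using solve xy by blast
    obtain v where v: "v \<in> carrier G" "v \<otimes> \<phi> (inv v) = y" using solve xy by blast
    have cancel: "inv u \<otimes> (u \<otimes> z) = z" "\<phi> (inv u) \<otimes> (\<phi> u \<otimes> z) = z" if "z \<in> carrier G" for z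
      using that u(1) cl by (simp_all add: inv m_assoc[symmetric])
    \<comment> \<open>\<open>u\<close> and \<open>v\<close> carry the identity to \<open>x\<close>
      and to \<open>y\<close>, so \<open>v \<otimes> inv u\<close> carries \<open>x\<close> to
      \<open>y\<close>.\<close>
    let ?g = "v \<otimes> inv u"
    have "twisted_conj G \<phi> ?g x = v \<otimes> inv u \<otimes> (u \<otimes> \<phi> (inv u)) \<otimes> (\<phi> u \<otimes> \<phi> (inv v))"
      using u v xy by (simp add: twisted_conj_def inv_mult_group mul)
    also have "\<dots> = y"
      using u(1) v cl by (simp add: m_assoc cancel)
    finally show "\<exists>g\<in>carrier G. twisted_conj G \<phi> g x = y" using u(1) v(1) by blast
  qed
qed

theorem theorem3p5:
  fixes G B :: "('k::{alg_closed_field, field_char_0}^'n^'n) set"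
  assumes "\<exists>S :: 'k set. transcendence_basis S \<and> countable S \<and> infinite S"
    and "simple_algebraic_group G"
    and "borel_subgroup B G"
  shows "\<exists>\<phi> \<in> auto (grp B).
    transitive_action (grp B) (carrier (grp B)) (twisted_conj (grp B) \<phi>)"
proof -
  interpret GL: group "GL :: ('k^'n^'n) monoid" by (rule group_GL)
  have G: "subgroup G GL" using assms(2) by (simp add: simple_algebraic_group_def algebraic_group_def)
  have BG: "subgroup B (grp G)" "closedin zariski B" "connectedin zariski B"
    using assms(3) by (auto simp: borel_subgroup_def closed_connected_solvable_subgroup_def)
  have B: "subgroup B GL" using GL.incl_subgroup[OF G BG(1)] .
  interpret B: group "grp B" by (rule subgroup.subgroup_is_group[OF B group_GL])
  obtain S :: "'k set" where "transcendence_basis S" "countable S" "infinite S" using assms(1) by blast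
  from lang_automorphism[OF this B BG(2,3)]
  obtain \<sigma> where \<sigma>: "field_auto \<sigma>" "map_matrix \<sigma> ` B = B"
      "\<And>y. y \<in> B \<Longrightarrow> \<exists>g\<in>B. map_matrix \<sigma> g = y ** g" by blast
  \<comment> \<open>\<open>Bij\<close>, and with it \<open>auto\<close>, consists of extensional
    functions, so the map has to be cut down to \<open>B\<close>.\<close>
  define \<phi> where "\<phi> = restrict (map_matrix \<sigma>) B"
  have closed: "A ** A' \<in> B" if "A \<in> B" "A' \<in> B" for A A'
    using subgroup.m_closed[OF B that] by simp
  have "inj_on (map_matrix \<sigma>) B"
    by (rule inj_onI) (simp add: vec_eq_iff field_auto_simps[OF \<sigma>(1)])
  then have "bij_betw \<phi> B B" using \<sigma>(2) unfolding bij_betw_def \<phi>_def by simp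
  then have "\<phi> \<in> Bij B" by (simp add: Bij_def \<phi>_def)
  moreover have "\<phi> \<in> hom (grp B) (grp B)"
    using \<sigma>(2) closed by (auto simp: hom_def \<phi>_def map_matrix_mult[OF \<sigma>(1)])
  ultimately have "\<phi> \<in> auto (grp B)" by (simp add: auto_def)
  moreover have "transitive_action (grp B) (carrier (grp B)) (twisted_conj (grp B) \<phi>)"
    by (rule B.twisted_conj_transitive[OF \<open>\<phi> \<in> auto (grp B)\<close>]) (use \<sigma>(3) in \<open>auto simp: \<phi>_def\<close>)
  ultimately show ?thesis by blast
qed

end
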